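(* For each integer $d\ge0$, the number $f_d(r)$ of $d$-dimensional faces of the Kostka polytope $P_r$ ($r\ge1$) is given by a polynomial in $r$ of degree exactly $3d+3$ with leading coefficient $\frac{1}{(3d+3)!}$.
   Context: For a positive integer $r$, a partition with at most $r$ parts is written as a non-increasing $r$-tuple of nonnegative integers; $\mathrm{Par}_r(n)$ is the set of such tuples with entries summing to $n$. For $\lambda,\mu\in\mathrm{Par}_r(n)$, $\lambda$ dominates $\mu$ if $\sum_{i=1}^k\lambda_i\ge\sum_{i=1}^k\mu_i$ for all $k\le r$. The $r$-Kostka cone $\mathcal{K}_r\subseteq\mathbb{R}^{2r}$ is the convex hull of all points $(\lambda_1,\dots,\lambda_r,\mu_1,\dots,\mu_r)$ with $\lambda,\mu\in\mathrm{Par}_r(n)$ for some $n$ and $\lambda$ dominating $\mu$. The Kostka polytope $P_r$ is the $(2r-2)$-dimensional polytope $\mathcal{K}_r\cap\{x:\sum_{i=1}^r(\lambda_i+\mu_i)=1\}$. *)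

theory Defs
  imports
    "HOL-Analysis.Analysis"
    "HOL-Analysis.Finite_Function_Topology"
    "HOL-Computational_Algebra.Polynomial"
begin

definition Par :: "nat \<Rightarrow> nat \<Rightarrow> nat list set" where
  "Par r n = {xs. length xs = r \<and> sorted_wrt (\<ge>) xs \<and> sum_list xs = n}"

definition dominates :: "nat list \<Rightarrow> nat list \<Rightarrow> bool" where
  "dominates la mu \<longleftrightarrow>
     length la = length mu \<and> (\<forall>k\<le>length la. sum_list (take k la) \<ge> sum_list (take k mu))"

text \<open>
  Since \<open>r\<close> varies, all the spaces \<open>\<real>\<^bsup>2r\<^esup>\<close> are realised inside one real vector space, the finitely
  supported functions \<^typ>\<open>nat \<Rightarrow>\<^sub>0 real\<close>, as the subspaces of vectors supported on \<open>{..<2 * r}\<close>.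
  \<^const>\<open>Poly_Mapping.nth\<close> turns a list of coordinates into such a vector, padding it with zeros:
  coordinate \<open>i - 1\<close> holds \<open>\<lambda>\<^sub>i\<close> and coordinate \<open>r + i - 1\<close> holds \<open>\<mu>\<^sub>i\<close>.
\<close>

definition kostka_point :: "nat list \<Rightarrow> nat list \<Rightarrow> nat \<Rightarrow>\<^sub>0 real" where
  "kostka_point la mu = Poly_Mapping.nth (map real (la @ mu))"

definition kostka_cone :: "nat \<Rightarrow> (nat \<Rightarrow>\<^sub>0 real) set" where
  "kostka_cone r =
     convex hull {kostka_point la mu | la mu n. la \<in> Par r n \<and> mu \<in> Par r n \<and> dominates la mu}"

definition kostka_polytope :: "nat \<Rightarrow> (nat \<Rightarrow>\<^sub>0 real) set" where
  "kostka_polytope r = kostka_cone r \<inter> {x. (\<Sum>i<2 * r. Poly_Mapping.lookup x i) = 1}"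

text \<open>
  The library's \<^const>\<open>aff_dim\<close> is restricted to Euclidean spaces, whereas \<^typ>\<open>nat \<Rightarrow>\<^sub>0 real\<close> is
  infinite-dimensional; the same notion makes sense in every real vector space.
\<close>

definition has_aff_dim :: "'a::real_vector set \<Rightarrow> nat \<Rightarrow> bool" where
  "has_aff_dim S d \<longleftrightarrow>
     (\<exists>B. affine hull B = affine hull S \<and> \<not> affine_dependent B \<and> card B = d + 1)"

lemma has_aff_dim_iff_aff_dim:
  fixes S :: "'a::euclidean_space set"
  shows "has_aff_dim S d \<longleftrightarrow> aff_dim S = int d"
proof
  assume "has_aff_dim S d"
  then obtain B where "affine hull B = affine hull S" "\<not> affine_dependent B" "card B = d + 1"
    unfolding has_aff_dim_def by blast
  with aff_dim_unique[of B S] show "aff_dim S = int d" by simp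
next
  assume "aff_dim S = int d"
  with aff_dim_basis_exists[of S] obtain B
    where "affine hull B = affine hull S" "\<not> affine_dependent B" "int (card B) = int d + 1"
    by auto
  then show "has_aff_dim S d"
    unfolding has_aff_dim_def by (intro exI[of _ B]) auto
qed

definition num_faces :: "'a::real_vector set \<Rightarrow> nat \<Rightarrow> nat" where
  "num_faces S d = card {F. F face_of S \<and> has_aff_dim F d}"

end

theory Submission
  imports Defs
begin

text \<open>
  Put \<open>a\<^sub>k = \<lambda>\<^sub>k - \<lambda>\<^sub>k\<^sub>+\<^sub>1\<close>, \<open>b\<^sub>k = \<mu>\<^sub>k - \<mu>\<^sub>k\<^sub>+\<^sub>1\<close> and \<open>D\<^sub>k = \<Sum>\<^sub>i\<^sub>\<le>\<^sub>k (\<lambda>\<^sub>i - \<mu>\<^sub>i)\<close>. The cone is cut out by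
  \<open>a, b, D \<ge> 0\<close> and \<open>D\<^sub>r = 0\<close>, and \<open>a\<^sub>k - b\<^sub>k = 2 D\<^sub>k - D\<^sub>k\<^sub>-\<^sub>1 - D\<^sub>k\<^sub>+\<^sub>1\<close>. Faces correspond to the sign
  patterns of \<open>(D, a, b)\<close> that occur. A pattern occurs iff every maximal run of positive \<open>D\<^sub>k\<close> contains
  some \<open>a\<^sub>k > 0\<close>, and \<open>b\<^sub>k > 0\<close> holds at a zero \<open>D\<^sub>k\<close> exactly if \<open>a\<^sub>k > 0\<close> or a neighbouring \<open>D\<close> is positive.
  The linear dimension of the face is the number of \<open>k\<close> with \<open>a\<^sub>k > 0\<close> plus the number of \<open>k\<close> with
  \<open>D\<^sub>k > 0\<close> and \<open>b\<^sub>k > 0\<close>.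

  Patterns are words accepted by a three-state automaton. Let \<open>A\<close>, \<open>B\<close>, \<open>C\<close> count the words of a given
  length by dimension, according to whether the first letter has \<open>D = 0\<close>, or lies in a run without
  \<open>a > 0\<close>, or lies in a run with \<open>a > 0\<close>. With \<open>t\<close> marking the dimension, adding a letter turns them into
  \<open>(1 + t)(A + C)\<close>, \<open>(1 + t)(A + B)\<close> and \<open>(1 + t) C + (t + t\<^sup>2)(A + B + C)\<close>. Comparing
  coefficients of \<open>t\<^sup>k\<close> expresses the differences of \<open>C\<^sub>k\<close>, \<open>A\<^sub>k\<close>, \<open>B\<^sub>k\<close> through \<open>B\<^sub>k\<^sub>-\<^sub>1\<close>, \<open>C\<^sub>k\<close>, \<open>A\<^sub>k\<close> and terms
  of lower degree, so each of these three steps raises the degree by one: \<open>A\<^sub>k\<close> is a polynomial of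
  degree \<open>3k\<close> with leading coefficient \<open>1 / (3k)!\<close>.
\<close>

section \<open>Faces and dimensions of a section of a polyhedral cone\<close>

text \<open>Applying \<open>\<sigma>\<close> to a linear combination of points of \<open>S\<close>
  returns its coefficient sum, so a combination landing on the hyperplane is already an affine
  one.\<close>

lemma affine_hull_eq_span_Int_hyperplane:
  fixes \<sigma> :: "'a::real_vector \<Rightarrow> real"
  assumes "linear \<sigma>" "\<And>x. x \<in> S \<Longrightarrow> \<sigma> x = 1"
  shows "affine hull S = {x \<in> span S. \<sigma> x = 1}"
proof
  interpret linear \<sigma> by fact
  have "affine {x. \<sigma> x = 1}"
    unfolding affine_def by (auto simp: add scale)
  then have "affine hull S \<subseteq> {x. \<sigma> x = 1}"
    using assms(2) by (intro hull_minimal) auto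
  then show "affine hull S \<subseteq> {x \<in> span S. \<sigma> x = 1}"
    using affine_hull_subset_span[of S] by auto
  show "{x \<in> span S. \<sigma> x = 1} \<subseteq> affine hull S"
  proof clarify
    fix x assume "x \<in> span S" and x1: "\<sigma> x = 1"
    then obtain T u where T: "finite T" "T \<subseteq> S" and x: "x = (\<Sum>v\<in>T. u v *\<^sub>R v)"
      unfolding span_explicit by auto
    have "sum u T = (\<Sum>v\<in>T. u v * \<sigma> v)"
      using T assms(2) by (intro sum.cong) auto
    also have "\<dots> = 1"
      using x1 by (simp add: x sum scale)
    finally have "sum u T = 1" .
    moreover have "T \<noteq> {}" using x x1 by (auto simp: zero)
    ultimately show "x \<in> affine hull S"
      unfolding affine_hull_explicit using T x by blast
  qed
qed

text \<open>Applying \<open>\<sigma>\<close> to a linear relation shows that its coefficients sum to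
  0, which is all an affine relation asks for in addition.\<close>

lemma affine_dependent_iff_dependent_hyperplane:
  fixes \<sigma> :: "'a::real_vector \<Rightarrow> real"
  assumes "linear \<sigma>" "\<And>x. x \<in> S \<Longrightarrow> \<sigma> x = 1"
  shows "affine_dependent S \<longleftrightarrow> dependent S"
proof
  show "affine_dependent S \<Longrightarrow> dependent S"
    by (rule affine_dependent_imp_dependent)
  interpret linear \<sigma> by fact
  assume "dependent S"
  then obtain T u v where T: "finite T" "T \<subseteq> S" and v: "v \<in> T" "u v \<noteq> 0"
    and 0: "(\<Sum>v\<in>T. u v *\<^sub>R v) = 0"
    unfolding dependent_explicit by auto
  have "sum u T = (\<Sum>v\<in>T. u v * \<sigma> v)"
    using T assms(2) by (intro sum.cong) auto
  also have "\<dots> = \<sigma> (\<Sum>v\<in>T. u v *\<^sub>R v)"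
    by (simp add: sum scale)
  also have "\<dots> = 0" by (simp add: 0 zero)
  finally have "sum u T = 0" .
  then show "affine_dependent S"
    unfolding affine_dependent_explicit using T v 0 by blast
qed

text \<open>The hyperplane misses the origin, hence the shift by one. Since \<open>d + 1\<close> is
  positive, infinite bases, for which \<open>card\<close> is 0, are excluded on both sides.\<close>

lemma has_aff_dim_iff_dim:
  fixes \<sigma> :: "'a::real_vector \<Rightarrow> real"
  assumes \<sigma>: "linear \<sigma>" "\<And>x. x \<in> S \<Longrightarrow> \<sigma> x = 1"
  shows "has_aff_dim S d \<longleftrightarrow> dim S = d + 1"
proof
  assume "has_aff_dim S d"
  then obtain B where B: "affine hull B = affine hull S" "\<not> affine_dependent B" "card B = d + 1"
    unfolding has_aff_dim_def by blast
  have B1: "\<sigma> x = 1" if "x \<in> B" for x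
    using hull_inc[OF that, of affine] B(1) affine_hull_eq_span_Int_hyperplane[OF \<sigma>] by auto
  have "span B = span S"
    using B(1) by (metis hull_subset affine_hull_subset_span span_eq subset_trans)
  moreover have "independent B"
    using B(2) affine_dependent_iff_dependent_hyperplane[OF \<sigma>(1) B1] by auto
  ultimately show "dim S = d + 1"
    using dim_eq_card B(3) by metis
next
  assume dim: "dim S = d + 1"
  obtain B where B: "B \<subseteq> S" "independent B" "S \<subseteq> span B" "card B = dim S"
    using basis_exists by blast
  have B1: "\<sigma> x = 1" if "x \<in> B" for x
    using that B(1) \<sigma>(2) by auto
  have "span B = span S"
    using B(1,3) by (simp add: span_eq span_superset subset_trans)
  then have "affine hull B = affine hull S"
    by (simp add: affine_hull_eq_span_Int_hyperplane[OF \<sigma>] affine_hull_eq_span_Int_hyperplane[OF \<sigma>(1) B1])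
  then show "has_aff_dim S d"
    unfolding has_aff_dim_def using B dim affine_dependent_iff_dependent_hyperplane[OF \<sigma>(1) B1] by auto
qed

section \<open>Dimensions of common kernels of linear functionals\<close>

lemma subspace_common_kernel:
  assumes "subspace V" "\<And>j. j \<in> N \<Longrightarrow> linear (g j :: _ \<Rightarrow> real)"
  shows "subspace {x \<in> V. \<forall>j\<in>N. g j x = 0}"
  using assms by (auto simp: subspace_def linear_0 linear_add linear_scale)

text \<open>A vector \<open>v\<close> with \<open>g v \<noteq> 0\<close> and a basis of the kernel
  together span \<open>V\<close>. The finite spanning set \<open>C\<close> keeps bases finite in an
  ambient space of infinite dimension.\<close>

lemma dim_le_dim_kernel:
  fixes g :: "'a::real_vector \<Rightarrow> real"
  assumes V: "subspace V" "V \<subseteq> span C" "finite C" and g: "linear g"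
  shows "dim V \<le> dim {x \<in> V. g x = 0} + 1"
proof (cases "\<exists>v\<in>V. g v \<noteq> 0")
  case False
  then have "{x \<in> V. g x = 0} = V" by auto
  then show ?thesis by simp
next
  case True
  then obtain v where v: "v \<in> V" "g v \<noteq> 0" by blast
  obtain B where B: "B \<subseteq> {x \<in> V. g x = 0}" "independent B" "{x \<in> V. g x = 0} \<subseteq> span B"
      "card B = dim {x \<in> V. g x = 0}"
    using basis_exists by blast
  have fin: "finite B"
    using independent_span_bound[OF V(3) B(2)] B(1) V(2) by auto
  have "V \<subseteq> span (insert v B)"
  proof
    fix x assume x: "x \<in> V"
    let ?y = "x - (g x / g v) *\<^sub>R v"
    have "?y \<in> {x \<in> V. g x = 0}"
      using v x V(1) g by (auto simp: linear_diff linear_scale subspace_diff subspace_scale)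
    then have "?y \<in> span B" using B(3) by blast
    then have "?y \<in> span (insert v B)"
      by (meson span_mono subset_insertI subsetD)
    moreover have "(g x / g v) *\<^sub>R v \<in> span (insert v B)"
      by (simp add: span_base span_scale)
    ultimately show "x \<in> span (insert v B)"
      by (metis diff_add_cancel span_add)
  qed
  then have "dim V \<le> card (insert v B)"
    using fin by (intro dim_le_card) auto
  also have "\<dots> \<le> card B + 1"
    by (simp add: card_insert_if fin)
  finally show ?thesis using B(4) by simp
qed

lemma dim_le_dim_common_kernel:
  fixes g :: "'i \<Rightarrow> 'a::real_vector \<Rightarrow> real"
  assumes V: "subspace V" "V \<subseteq> span C" "finite C" and "finite N"
    and g: "\<And>j. j \<in> N \<Longrightarrow> linear (g j)"
  shows "dim V \<le> dim {x \<in> V. \<forall>j\<in>N. g j x = 0} + card N"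
  using \<open>finite N\<close> g
proof (induction N rule: finite_induct)
  case (insert i N)
  let ?W = "{x \<in> V. \<forall>j\<in>N. g j x = 0}"
  have "dim ?W \<le> dim {x \<in> ?W. g i x = 0} + 1"
    using V insert.prems by (intro dim_le_dim_kernel subspace_common_kernel) auto
  moreover have "{x \<in> ?W. g i x = 0} = {x \<in> V. \<forall>j\<in>insert i N. g j x = 0}" by auto
  ultimately show ?case using insert by auto
qed simp

text \<open>Killing the functionals of \<open>N\<close> costs at most \<open>card N\<close>
  dimensions, killing the remaining ones at most \<open>card (J - N)\<close> more, and by
  \<open>inj\<close> this ends at 0. As \<open>dim V = card J\<close>, both bounds are sharp: the
  functionals of \<open>J\<close> act as coordinates on \<open>V\<close>.\<close>

lemma dim_common_kernel_eq:
  fixes g :: "'i \<Rightarrow> 'a::real_vector \<Rightarrow> real"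
  assumes V: "subspace V" "V \<subseteq> span C" "finite C" and J: "finite J" "dim V = card J"
    and g: "\<And>j. j \<in> J \<Longrightarrow> linear (g j)"
    and inj: "\<And>x. x \<in> V \<Longrightarrow> (\<And>j. j \<in> J \<Longrightarrow> g j x = 0) \<Longrightarrow> x = 0"
    and "N \<subseteq> J"
  shows "dim {x \<in> V. \<forall>j\<in>N. g j x = 0} = card (J - N)"
proof -
  let ?W = "{x \<in> V. \<forall>j\<in>N. g j x = 0}"
  have fin: "finite N" using J(1) \<open>N \<subseteq> J\<close> by (rule rev_finite_subset)
  have "dim V \<le> dim ?W + card N"
    using V fin g \<open>N \<subseteq> J\<close> by (intro dim_le_dim_common_kernel) auto
  moreover have "dim ?W \<le> dim {x \<in> ?W. \<forall>j\<in>J - N. g j x = 0} + card (J - N)"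
    using V J(1) g \<open>N \<subseteq> J\<close>
    by (intro dim_le_dim_common_kernel subspace_common_kernel) auto
  moreover have "dim {x \<in> ?W. \<forall>j\<in>J - N. g j x = 0} \<le> card ({} :: 'a set)"
  proof (rule dim_le_card)
    show "{x \<in> ?W. \<forall>j\<in>J - N. g j x = 0} \<subseteq> span {}"
    proof
      fix x assume x: "x \<in> {x \<in> ?W. \<forall>j\<in>J - N. g j x = 0}"
      then have "g j x = 0" if "j \<in> J" for j
        using that by (cases "j \<in> N") simp_all
      with x inj[of x] show "x \<in> span {}" by simp
    qed
  qed simp
  ultimately show ?thesis
    using J fin \<open>N \<subseteq> J\<close> by (simp add: card_Diff_subset)
qed

text \<open>Equations are kept in the subspace \<open>V\<close>, so that faces are described by
  which of the inequalities \<open>f i \<ge> 0\<close> are tight.\<close>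

locale cone_section =
  fixes V :: "'a::real_vector set" and I :: "'i set" and f :: "'i \<Rightarrow> 'a \<Rightarrow> real" and \<sigma> :: "'a \<Rightarrow> real"
  assumes subspace_V: "subspace V" and finite_I: "finite I"
    and linear_f: "\<And>i. linear (f i)" and linear_\<sigma>: "linear \<sigma>"
begin

definition slice :: "'a set" where
  "slice = {x \<in> V. (\<forall>i\<in>I. f i x \<ge> 0) \<and> \<sigma> x = 1}"

text \<open>For \<open>x\<close> in \<open>slice\<close> this is the smallest face containing
  \<open>x\<close>; \<open>carrier_at x\<close> will turn out to be its linear span.\<close>

definition face_at :: "'a \<Rightarrow> 'a set" where
  "face_at x = {y \<in> slice. \<forall>i\<in>I. f i x = 0 \<longrightarrow> f i y = 0}"

definition carrier_at :: "'a \<Rightarrow> 'a set" where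
  "carrier_at x = {y \<in> V. \<forall>i\<in>I. f i x = 0 \<longrightarrow> f i y = 0}"

lemma convex_slice: "convex slice"
  unfolding convex_def slice_def
  using subspace_V linear_f linear_\<sigma>
  by (auto simp: linear_add linear_scale subspace_add subspace_scale)

text \<open>Inequalities strict at \<open>x\<close> survive a small move by continuity, tight ones
  stay tight along \<open>carrier_at x\<close>; finiteness of \<open>I\<close> lets one bound on
  \<open>t\<close> serve all of them.\<close>

lemma eventually_nonneg_perturbation:
  assumes "x \<in> slice" "y \<in> carrier_at x"
  shows "eventually (\<lambda>t. \<forall>i\<in>I. f i (x + t *\<^sub>R y) \<ge> 0) (at_right 0)"
proof -
  have "eventually (\<lambda>t. f i (x + t *\<^sub>R y) \<ge> 0) (at_right 0)" if i: "i \<in> I" for i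
  proof (cases "f i x = 0")
    case True
    then show ?thesis
      using assms i linear_f by (auto simp: carrier_at_def linear_add linear_scale)
  next
    case False
    then have "f i x > 0" using assms i by (force simp: slice_def)
    moreover have "((\<lambda>t. f i x + t * f i y) \<longlongrightarrow> f i x + 0 * f i y) (at_right 0)"
      by (intro tendsto_intros)
    ultimately have "eventually (\<lambda>t. f i x + t * f i y > 0) (at_right 0)"
      by (intro order_tendstoD(1)) auto
    then show ?thesis
      by eventually_elim (simp add: linear_f linear_add linear_scale)
  qed
  then show ?thesis
    using finite_I by (simp add: eventually_ball_finite)
qed

lemma face_at_face_of: "face_at x face_of slice"
proof -
  have "a \<in> face_at x" if a: "a \<in> slice" "b \<in> slice" and y: "y \<in> face_at x" "y \<in> open_segment a b" for a b y
  proof -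
    obtain u where u: "0 < u" "u < 1" "y = (1 - u) *\<^sub>R a + u *\<^sub>R b"
      using y(2) by (auto simp: in_segment)
    have "f i a = 0" if i: "i \<in> I" "f i x = 0" for i
    proof -
      have "(1 - u) * f i a + u * f i b = 0"
        using y(1) i u(3) linear_f[of i] by (auto simp: face_at_def linear_add linear_scale)
      moreover have "f i a \<ge> 0" "f i b \<ge> 0"
        using a i by (auto simp: slice_def)
      ultimately show ?thesis
        using u(1,2) by (simp add: add_nonneg_eq_0_iff)
    qed
    then show ?thesis using a by (simp add: face_at_def)
  qed
  moreover have "convex (face_at x)"
    using convex_slice linear_f
    unfolding convex_def face_at_def by (auto simp: linear_add linear_scale)
  moreover have "face_at x \<subseteq> slice" by (auto simp: face_at_def)
  ultimately show ?thesis
    unfolding face_of_def by (metis open_segment_commute)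
qed

text \<open>A point of \<open>F\<close> with the fewest tight inequalities plays the part of a
  relative interior point: a midpoint keeps only the common tight inequalities, so by minimality
  those of \<open>x\<close> are tight on all of \<open>F\<close>. Conversely, a segment from a point
  of \<open>face_at x\<close> to \<open>x\<close> can be prolonged beyond \<open>x\<close> inside
  \<open>slice\<close>, and the face property pulls its starting point into
  \<open>F\<close>.\<close>

lemma face_of_eq_face_at:
  assumes F: "F face_of slice" "F \<noteq> {}"
  shows "\<exists>x\<in>slice. F = face_at x"
proof -
  define Z where "Z x = {i \<in> I. f i x = 0}" for x
  have fin: "finite (Z x)" for x using finite_I by (simp add: Z_def)
  have FP: "F \<subseteq> slice" and cF: "convex F" using F by (auto simp: face_of_def)
  obtain x where x: "x \<in> F" and min: "\<And>y. y \<in> F \<Longrightarrow> card (Z x) \<le> card (Z y)"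
    using F(2) ex_has_least_nat[of "\<lambda>x. x \<in> F" _ "\<lambda>x. card (Z x)"] by blast
  have "Z x \<subseteq> Z y" if y: "y \<in> F" for y
  proof -
    define m where "m = (1/2) *\<^sub>R x + (1/2) *\<^sub>R y"
    have m: "m \<in> F"
      unfolding m_def using cF x y by (intro convexD) auto
    have "Z m \<subseteq> Z x \<inter> Z y"
    proof
      fix i assume i: "i \<in> Z m"
      then have "f i x + f i y = 0"
        using linear_f[of i] by (auto simp: Z_def m_def linear_add linear_scale)
      moreover have "f i x \<ge> 0" "f i y \<ge> 0"
        using i x y FP by (auto simp: Z_def slice_def)
      ultimately show "i \<in> Z x \<inter> Z y"
        using i by (auto simp: Z_def)
    qed
    moreover have "Z m = Z x"
      using calculation min[OF m] by (intro card_subset_eq fin) (auto intro: le_antisym card_mono fin)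
    ultimately show ?thesis by blast
  qed
  then have "F \<subseteq> face_at x"
    using FP by (auto simp: face_at_def Z_def)
  moreover have "y \<in> F" if y: "y \<in> face_at x" for y
  proof (cases "y = x")
    case False
    have y': "y \<in> slice" "x \<in> slice" using y x FP by (auto simp: face_at_def)
    have "x - y \<in> carrier_at x"
      using y y' subspace_V linear_f
      by (auto simp: carrier_at_def face_at_def slice_def linear_diff subspace_diff)
    from eventually_nonneg_perturbation[OF y'(2) this]
    have "eventually (\<lambda>t. (\<forall>i\<in>I. f i (x + t *\<^sub>R (x - y)) \<ge> 0) \<and> t > 0) (at_right 0)"
      by (intro eventually_conj) (auto simp: eventually_at_right_less)
    then obtain t where t: "t > 0" "\<forall>i\<in>I. f i (x + t *\<^sub>R (x - y)) \<ge> 0"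
      using eventually_happens[of _ "at_right (0::real)"] by auto
    define z where "z = x + t *\<^sub>R (x - y)"
    have z: "z \<in> slice"
      using t y' subspace_V linear_\<sigma>
      by (auto simp: z_def slice_def linear_add linear_scale linear_diff subspace_add subspace_scale subspace_diff)
    \<comment> \<open>The weight that places \<open>x\<close> on the segment from \<open>y\<close>
      to its prolongation \<open>z\<close>.\<close>
    define s where "s = 1 / (1 + t)"
    have s: "s * (1 + t) = 1" "0 < s" "s < 1" using t(1) by (auto simp: s_def field_simps)
    have "(1 - s) *\<^sub>R y + s *\<^sub>R z = (1 - s * (1 + t)) *\<^sub>R y + (s * (1 + t)) *\<^sub>R x"
      by (simp add: z_def algebra_simps)
    then have "x = (1 - s) *\<^sub>R y + s *\<^sub>R z" by (simp add: s(1))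
    moreover have "y \<noteq> z"
    proof
      assume "y = z"
      then have "(1 + t) *\<^sub>R (x - y) = 0" by (simp add: z_def algebra_simps)
      then show False using False t(1) by auto
    qed
    ultimately have "x \<in> open_segment y z"
      unfolding in_segment using s(2,3) by blast
    then show ?thesis
      using F(1) y'(1) z x by (meson face_ofD)
  qed (use x in simp)
  ultimately show ?thesis using x FP by blast
qed

lemma face_at_eq_iff:
  assumes "x \<in> slice" "y \<in> slice"
  shows "face_at x = face_at y \<longleftrightarrow> (\<forall>i\<in>I. f i x = 0 \<longleftrightarrow> f i y = 0)"
proof
  assume *: "face_at x = face_at y"
  have "x \<in> face_at x" "y \<in> face_at y" using assms by (auto simp: face_at_def)
  then have "x \<in> face_at y" "y \<in> face_at x" using * by auto
  then show "\<forall>i\<in>I. f i x = 0 \<longleftrightarrow> f i y = 0"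
    by (auto simp: face_at_def)
qed (auto simp: face_at_def)

text \<open>A direction \<open>y\<close> in the carrier is a combination of \<open>x\<close> and the
  nearby point \<open>x + t *\<^sub>R y\<close>, which lies in \<open>face_at x\<close> after
  rescaling by its positive \<open>\<sigma>\<close>-value \<open>c\<close>.\<close>

lemma span_face_at:
  assumes x: "x \<in> slice"
  shows "span (face_at x) = carrier_at x"
proof
  have "subspace (carrier_at x)"
    using subspace_V linear_f
    by (auto simp: carrier_at_def subspace_def linear_0 linear_add linear_scale)
  then show "span (face_at x) \<subseteq> carrier_at x"
    by (intro span_minimal) (auto simp: face_at_def carrier_at_def slice_def)
  show "carrier_at x \<subseteq> span (face_at x)"
  proof
    fix y assume y: "y \<in> carrier_at x"
    have "((\<lambda>t. 1 + t * \<sigma> y) \<longlongrightarrow> 1 + 0 * \<sigma> y) (at_right 0)"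
      by (intro tendsto_intros)
    then have "eventually (\<lambda>t. 1 + t * \<sigma> y > 0) (at_right 0)"
      by (intro order_tendstoD(1)) auto
    then have "eventually (\<lambda>t. ((\<forall>i\<in>I. f i (x + t *\<^sub>R y) \<ge> 0) \<and> t > 0) \<and> 1 + t * \<sigma> y > 0) (at_right 0)"
      using eventually_nonneg_perturbation[OF x y]
      by (intro eventually_conj) (auto simp: eventually_at_right_less)
    then obtain t where t: "t > 0" "\<forall>i\<in>I. f i (x + t *\<^sub>R y) \<ge> 0" "1 + t * \<sigma> y > 0"
      using eventually_happens[of _ "at_right (0::real)"] by auto
    define c where "c = 1 + t * \<sigma> y"
    define z where "z = (1 / c) *\<^sub>R (x + t *\<^sub>R y)"
    have fz: "f i z = f i (x + t *\<^sub>R y) / c" for i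
      using linear_f by (simp add: z_def linear_scale)
    have "\<sigma> z = (\<sigma> x + t * \<sigma> y) / c"
      using linear_\<sigma> by (simp add: z_def linear_scale linear_add add_divide_distrib)
    then have "\<sigma> z = 1" using t x by (simp add: c_def slice_def)
    moreover have "z \<in> V"
      using x y subspace_V by (auto simp: z_def slice_def carrier_at_def subspace_add subspace_scale)
    moreover have "f i z \<ge> 0" if "i \<in> I" for i
      using t that by (simp add: fz c_def)
    moreover have "f i z = 0" if "i \<in> I" "f i x = 0" for i
      using y that linear_f[of i] by (simp add: fz carrier_at_def linear_add linear_scale)
    ultimately have "z \<in> face_at x"
      by (simp add: face_at_def slice_def)
    moreover have "x \<in> face_at x" using x by (auto simp: face_at_def)
    moreover have "y = (c / t) *\<^sub>R z - (1 / t) *\<^sub>R x"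
      using t by (simp add: z_def c_def scaleR_add_right)
    ultimately show "y \<in> span (face_at x)"
      by (simp add: span_base span_diff span_scale)
  qed
qed

lemma num_faces_slice: "num_faces slice d = card (face_at ` {x \<in> slice. dim (carrier_at x) = d + 1})"
proof -
  have dim: "has_aff_dim (face_at x) d \<longleftrightarrow> dim (carrier_at x) = d + 1" if "x \<in> slice" for x
  proof -
    have "\<sigma> y = 1" if "y \<in> face_at x" for y
      using that by (simp add: face_at_def slice_def)
    then have "has_aff_dim (face_at x) d \<longleftrightarrow> dim (face_at x) = d + 1"
      by (rule has_aff_dim_iff_dim[OF linear_\<sigma>])
    then show ?thesis
      using span_face_at[OF that] dim_span[of "face_at x"] by simp
  qed
  \<comment> \<open>The empty set is also a face, but not one of the form \<open>face_at x\<close>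
    with \<open>x\<close> in \<open>slice\<close>.\<close>
  have empty: "\<not> has_aff_dim ({} :: 'a set) d"
    unfolding has_aff_dim_def by auto
  have "{F. F face_of slice \<and> has_aff_dim F d} = face_at ` {x \<in> slice. dim (carrier_at x) = d + 1}"
  proof (intro equalityI subsetI)
    fix F assume F: "F \<in> {F. F face_of slice \<and> has_aff_dim F d}"
    then obtain x where "x \<in> slice" "F = face_at x"
      using face_of_eq_face_at[of F] empty by blast
    then show "F \<in> face_at ` {x \<in> slice. dim (carrier_at x) = d + 1}"
      using F dim by blast
  qed (use face_at_face_of dim in blast)
  then show ?thesis by (simp add: num_faces_def)
qed

end

section \<open>The inequalities of the Kostka cone\<close>

lemma lookup_scaleR [simp]:
  "Poly_Mapping.lookup (c *\<^sub>R x) i = c *\<^sub>R Poly_Mapping.lookup x i"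
  by (simp add: scaleR_poly_mapping_def)

lemma linear_lookup: "linear (\<lambda>x :: 'a \<Rightarrow>\<^sub>0 real. Poly_Mapping.lookup x i)"
  by (rule linearI) (simp_all add: lookup_add)

definition coord_space :: "nat \<Rightarrow> (nat \<Rightarrow>\<^sub>0 real) set" where
  "coord_space n = {x. \<forall>i\<ge>n. Poly_Mapping.lookup x i = 0}"

lemma subspace_coord_space: "subspace (coord_space n)"
  by (auto simp: subspace_def coord_space_def lookup_add)

lemma coord_space_basis:
  defines "B n \<equiv> (\<lambda>i. Poly_Mapping.single i (1 :: real)) ` {..<n}"
  shows "coord_space n \<subseteq> span (B n)" and "dim (coord_space n) = n"
proof -
  let ?e = "\<lambda>i::nat. Poly_Mapping.single i (1 :: real)"
  have inj: "inj ?e"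
    by (rule injI) (metis lookup_single_eq lookup_single_not_eq zero_neq_one)
  then have inj_on: "inj_on ?e {..<n}" by (rule inj_on_subset) simp
  show span: "coord_space n \<subseteq> span (B n)"
  proof
    fix x :: "nat \<Rightarrow>\<^sub>0 real" assume x: "x \<in> coord_space n"
    have "x = (\<Sum>i<n. Poly_Mapping.lookup x i *\<^sub>R ?e i)"
    proof (rule poly_mapping_eqI)
      fix k
      have "Poly_Mapping.lookup (\<Sum>i<n. Poly_Mapping.lookup x i *\<^sub>R ?e i) k =
          (\<Sum>i<n. if i = k then Poly_Mapping.lookup x i else 0)"
        unfolding lookup_sum by (intro sum.cong) (auto simp: lookup_single when_def)
      then show "Poly_Mapping.lookup x k = Poly_Mapping.lookup (\<Sum>i<n. Poly_Mapping.lookup x i *\<^sub>R ?e i) k"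
        using x by (simp add: coord_space_def)
    qed
    also have "\<dots> \<in> span (B n)"
      by (intro span_sum span_scale span_base) (auto simp: B_def)
    finally show "x \<in> span (B n)" .
  qed
  have "independent (B n)"
  proof
    assume "dependent (B n)"
    then obtain u v where v: "v \<in> B n" "u v \<noteq> 0" and 0: "(\<Sum>v\<in>B n. u v *\<^sub>R v) = 0"
      using dependent_finite[of "B n"] by (auto simp: B_def)
    obtain k where k: "k < n" "v = ?e k" using v(1) by (auto simp: B_def)
    have "0 = Poly_Mapping.lookup (\<Sum>i<n. u (?e i) *\<^sub>R ?e i) k"
      using 0 inj_on by (simp add: B_def sum.reindex)
    also have "\<dots> = (\<Sum>i<n. if i = k then u (?e i) else 0)"
      unfolding lookup_sum by (intro sum.cong) (auto simp: lookup_single when_def)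
    also have "\<dots> = u (?e k)" using k by simp
    finally show False using v k by simp
  qed
  moreover have "B n \<subseteq> coord_space n"
    by (auto simp: B_def coord_space_def lookup_single when_def)
  moreover have "card (B n) = n"
    using inj_on by (simp add: B_def card_image)
  ultimately show "dim (coord_space n) = n"
    using span by (metis basis_card_eq_dim)
qed

text \<open>Indices of parts start at 0, and both partitions are padded with zeros beyond index \<open>r - 1\<close>;
  the partial sums \<open>D\<^sub>k\<close> and the differences \<open>a\<^sub>k\<close>, \<open>b\<^sub>k\<close> are indexed by \<open>1, \<dots>, r\<close>.\<close>

definition lambda_part :: "nat \<Rightarrow> (nat \<Rightarrow>\<^sub>0 real) \<Rightarrow> nat \<Rightarrow> real" where
  "lambda_part r x i = (if i < r then Poly_Mapping.lookup x i else 0)"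

definition mu_part :: "nat \<Rightarrow> (nat \<Rightarrow>\<^sub>0 real) \<Rightarrow> nat \<Rightarrow> real" where
  "mu_part r x i = (if i < r then Poly_Mapping.lookup x (r + i) else 0)"

definition surplus :: "nat \<Rightarrow> (nat \<Rightarrow>\<^sub>0 real) \<Rightarrow> nat \<Rightarrow> real" where
  "surplus r x k = (\<Sum>i<k. lambda_part r x i - mu_part r x i)"

datatype facet = Dom nat | Lam nat | Mu nat

text \<open>Because of the zero padding, \<open>Lam r\<close> and \<open>Mu r\<close> are the last
  parts themselves, so nonnegativity of all parts is among the inequalities.\<close>

primrec facet_fun :: "nat \<Rightarrow> facet \<Rightarrow> (nat \<Rightarrow>\<^sub>0 real) \<Rightarrow> real" where
  "facet_fun r (Dom k) x = surplus r x k"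
| "facet_fun r (Lam k) x = lambda_part r x (k - 1) - lambda_part r x k"
| "facet_fun r (Mu k) x = mu_part r x (k - 1) - mu_part r x k"

definition facets :: "nat \<Rightarrow> facet set" where
  "facets r = Dom ` {1..r} \<union> Lam ` {1..r} \<union> Mu ` {1..r}"

definition kostka_space :: "nat \<Rightarrow> (nat \<Rightarrow>\<^sub>0 real) set" where
  "kostka_space r = {x \<in> coord_space (2 * r). surplus r x r = 0}"

definition ineq_cone :: "nat \<Rightarrow> (nat \<Rightarrow>\<^sub>0 real) set" where
  "ineq_cone r = {x \<in> kostka_space r. \<forall>c\<in>facets r. facet_fun r c x \<ge> 0}"

lemma finite_facets: "finite (facets r)"
  by (simp add: facets_def)

lemma linear_facet_fun: "linear (facet_fun r c)"
proof (cases c)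
  case (Dom k)
  have eq: "facet_fun r c = (\<lambda>x. surplus r x k)" by (simp add: Dom fun_eq_iff)
  have "linear (\<lambda>x. lambda_part r x i - mu_part r x i)" for i
    by (rule linearI) (simp_all add: lambda_part_def mu_part_def lookup_add algebra_simps)
  then show ?thesis
    unfolding eq surplus_def by (intro linear_compose_sum) auto
next
  case (Lam k)
  have "facet_fun r c = (\<lambda>x. lambda_part r x (k - 1) - lambda_part r x k)" by (simp add: Lam fun_eq_iff)
  then show ?thesis
    by (simp add: linearI lambda_part_def lookup_add right_diff_distrib)
next
  case (Mu k)
  have "facet_fun r c = (\<lambda>x. mu_part r x (k - 1) - mu_part r x k)" by (simp add: Mu fun_eq_iff)
  then show ?thesis
    by (simp add: linearI mu_part_def lookup_add right_diff_distrib)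
qed

lemma subspace_kostka_space: "subspace (kostka_space r)"
proof -
  have eq: "kostka_space r = {x \<in> coord_space (2 * r). \<forall>c\<in>{Dom r}. facet_fun r c x = 0}"
    by (auto simp: kostka_space_def)
  show ?thesis
    unfolding eq by (intro subspace_common_kernel subspace_coord_space linear_facet_fun)
qed

text \<open>This identity couples the three families: \<open>a\<^sub>k - b\<^sub>k\<close> measures
  the concavity of \<open>D\<close> at \<open>k\<close>. The padding makes it valid at
  \<open>k = r\<close> as well.\<close>

lemma second_difference:
  assumes "k \<ge> 1"
  shows "facet_fun r (Lam k) x - facet_fun r (Mu k) x =
    2 * surplus r x k - surplus r x (k - 1) - surplus r x (k + 1)"
proof -
  obtain m where "k = Suc m" using assms by (cases k) auto
  then show ?thesis by (simp add: surplus_def)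
qed

lemma surplus_0 [simp]: "surplus r x 0 = 0"
  by (simp add: surplus_def)

lemma surplus_beyond:
  assumes "x \<in> kostka_space r" "k \<ge> r"
  shows "surplus r x k = 0"
  using assms(2)
proof (induction k rule: dec_induct)
  case base
  then show ?case using assms(1) by (simp add: kostka_space_def)
next
  case (step k)
  then show ?case by (simp add: surplus_def lambda_part_def mu_part_def)
qed

lemma ineq_coneD:
  assumes "x \<in> ineq_cone r"
  shows "surplus r x k \<ge> 0" and "1 \<le> k \<Longrightarrow> k \<le> r \<Longrightarrow> facet_fun r (Lam k) x \<ge> 0"
    and "1 \<le> k \<Longrightarrow> k \<le> r \<Longrightarrow> facet_fun r (Mu k) x \<ge> 0"
proof -
  have nn: "facet_fun r c x \<ge> 0" if "c \<in> facets r" for c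
    using assms that by (simp add: ineq_cone_def)
  show "1 \<le> k \<Longrightarrow> k \<le> r \<Longrightarrow> facet_fun r (Lam k) x \<ge> 0"
    "1 \<le> k \<Longrightarrow> k \<le> r \<Longrightarrow> facet_fun r (Mu k) x \<ge> 0"
    using nn[of "Lam k"] nn[of "Mu k"] by (auto simp: facets_def)
  consider "k = 0" | "1 \<le> k" "k \<le> r" | "k \<ge> r" by linarith
  then show "surplus r x k \<ge> 0"
  proof cases
    case 2
    then show ?thesis using nn[of "Dom k"] by (auto simp: facets_def)
  next
    case 3
    then show ?thesis using surplus_beyond[of x r k] assms by (simp add: ineq_cone_def)
  qed simp
qed

lemma lambda_part_zero:
  assumes "\<And>k. 1 \<le> k \<Longrightarrow> k \<le> r \<Longrightarrow> facet_fun r (Lam k) x = 0" "i \<le> r"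
  shows "lambda_part r x i = 0"
  using assms(2)
proof (induction i rule: inc_induct)
  case (step i)
  then show ?case using assms(1)[of "Suc i"] by simp
qed (simp add: lambda_part_def)

lemma mu_part_zero:
  assumes "\<And>k. 1 \<le> k \<Longrightarrow> k \<le> r \<Longrightarrow> facet_fun r (Mu k) x = 0" "i \<le> r"
  shows "mu_part r x i = 0"
  using assms(2)
proof (induction i rule: inc_induct)
  case (step i)
  then show ?case using assms(1)[of "Suc i"] by simp
qed (simp add: mu_part_def)

lemma parts_nonneg:
  assumes "x \<in> ineq_cone r" "i \<le> r"
  shows "lambda_part r x i \<ge> 0" "mu_part r x i \<ge> 0"
proof -
  show "lambda_part r x i \<ge> 0" using assms(2)
  proof (induction i rule: inc_induct)
    case (step i)
    then show ?case using ineq_coneD(2)[OF assms(1), of "Suc i"] by simp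
  qed (simp add: lambda_part_def)
  show "mu_part r x i \<ge> 0" using assms(2)
  proof (induction i rule: inc_induct)
    case (step i)
    then show ?case using ineq_coneD(3)[OF assms(1), of "Suc i"] by simp
  qed (simp add: mu_part_def)
qed

lemma coord_space_eq_0I:
  assumes "x \<in> coord_space (2 * r)" "\<And>i. i < r \<Longrightarrow> lambda_part r x i = 0" "\<And>i. i < r \<Longrightarrow> mu_part r x i = 0"
  shows "x = 0"
proof (rule poly_mapping_eqI)
  fix i
  consider "i < r" | "r \<le> i" "i < 2 * r" | "i \<ge> 2 * r" by linarith
  then show "Poly_Mapping.lookup x i = Poly_Mapping.lookup 0 i"
  proof cases
    case 1
    then show ?thesis using assms(2)[of i] by (simp add: lambda_part_def)
  next
    case 2
    then show ?thesis using assms(3)[of "i - r"] by (simp add: mu_part_def)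
  next
    case 3
    then show ?thesis using assms(1) by (simp add: coord_space_def)
  qed
qed

text \<open>Allows every nonzero point of the cone to be rescaled into the polytope.\<close>

lemma coord_sum_pos:
  assumes x: "x \<in> ineq_cone r" "x \<noteq> 0"
  shows "(\<Sum>i<2 * r. Poly_Mapping.lookup x i) > 0"
proof -
  have nn: "Poly_Mapping.lookup x i \<ge> 0" if "i < 2 * r" for i
  proof (cases "i < r")
    case True
    then show ?thesis using parts_nonneg(1)[OF x(1), of i] by (simp add: lambda_part_def)
  next
    case False
    then have "i - r < r" "r + (i - r) = i" using that by auto
    then show ?thesis using parts_nonneg(2)[OF x(1), of "i - r"] by (simp add: mu_part_def)
  qed
  have "(\<Sum>i<2 * r. Poly_Mapping.lookup x i) \<noteq> 0"
  proof
    assume "(\<Sum>i<2 * r. Poly_Mapping.lookup x i) = 0"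
    then have "\<forall>i\<in>{..<2 * r}. Poly_Mapping.lookup x i = 0"
      using nn by (subst (asm) sum_nonneg_eq_0_iff) auto
    moreover have "x \<in> coord_space (2 * r)" using x by (simp add: ineq_cone_def kostka_space_def)
    ultimately have "x = 0"
      by (intro coord_space_eq_0I[of x r]) (auto simp: lambda_part_def mu_part_def)
    then show False using x(2) by simp
  qed
  moreover have "(\<Sum>i<2 * r. Poly_Mapping.lookup x i) \<ge> 0"
    using nn by (intro sum_nonneg) auto
  ultimately show ?thesis by simp
qed

text \<open>At its first nonzero value \<open>u\<close> leaves zero with slope \<open>c\<close>;
  being nonzero from there on, it must continue linearly and cannot be back at zero at
  \<open>r\<close>. This will give the injectivity of the coordinates used for the dimension
  count.\<close>

lemma discrete_harmonic_zero:
  fixes u :: "nat \<Rightarrow> real"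
  assumes "u 0 = 0" "u r = 0"
    and harm: "\<And>k. 0 < k \<Longrightarrow> k < r \<Longrightarrow> u k \<noteq> 0 \<Longrightarrow> 2 * u k = u (k - 1) + u (k + 1)"
    and "k \<le> r"
  shows "u k = 0"
proof (rule ccontr)
  assume "u k \<noteq> 0"
  define j where "j = (LEAST k. u k \<noteq> 0)"
  have j: "u j \<noteq> 0" "j \<le> k"
    unfolding j_def using LeastI[of "\<lambda>k. u k \<noteq> 0", OF \<open>u k \<noteq> 0\<close>]
      Least_le[of "\<lambda>k. u k \<noteq> 0", OF \<open>u k \<noteq> 0\<close>] by auto
  have least: "u i = 0" if "i < j" for i
    using not_less_Least[of i "\<lambda>k. u k \<noteq> 0"] that by (auto simp: j_def)
  have "j \<noteq> 0" using j(1) assms(1) by metis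
  then obtain i where i: "j = Suc i" by (cases j) auto
  define c where "c = u j"
  have lin: "u (i + n) = real n * c \<and> u (Suc (i + n)) = real (Suc n) * c" if "i + n < r" for n
    using that
  proof (induction n)
    case 0
    then show ?case using least[of i] i by (simp add: c_def)
  next
    case (Suc n)
    then have IH: "u (i + n) = real n * c" "u (Suc (i + n)) = real (Suc n) * c" by auto
    have "u (Suc (i + n)) \<noteq> 0" using IH j(1) by (simp add: c_def)
    then have "2 * u (Suc (i + n)) = u (i + n) + u (Suc (Suc (i + n)))"
      using harm[of "Suc (i + n)"] Suc.prems by simp
    then show ?case using IH by (simp add: algebra_simps)
  qed
  have "i < r" using i j(2) \<open>k \<le> r\<close> by simp
  then have "u r = real (r - i) * c"
    using lin[of "r - 1 - i"] by (simp add: Suc_diff_Suc)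
  then show False using assms(2) \<open>i < r\<close> j(1) by (simp add: c_def)
qed

section \<open>Sign patterns and extremal rays\<close>

text \<open>Since \<open>d\<close> is false at 0 and from \<open>r\<close> on, the neighbours
  \<open>k - 1\<close> and \<open>k + 1\<close> make sense at both ends. A run is addressed through
  the zero \<open>i\<close> just before it.\<close>

definition valid_pattern :: "nat \<Rightarrow> (nat \<Rightarrow> bool) \<Rightarrow> (nat \<Rightarrow> bool) \<Rightarrow> (nat \<Rightarrow> bool) \<Rightarrow> bool" where
  "valid_pattern r d a b \<longleftrightarrow>
     \<not> d 0 \<and> (\<forall>k\<ge>r. \<not> d k) \<and>
     (\<forall>k. 1 \<le> k \<and> k \<le> r \<and> \<not> d k \<longrightarrow> (b k \<longleftrightarrow> a k \<or> d (k - 1) \<or> d (k + 1))) \<and>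
     (\<forall>i<r. \<not> d i \<and> d (Suc i) \<longrightarrow> (\<exists>m>i. m \<le> r \<and> a m \<and> (\<forall>j. i < j \<and> j \<le> m \<longrightarrow> d j)))"

primrec in_pattern :: "(nat \<Rightarrow> bool) \<Rightarrow> (nat \<Rightarrow> bool) \<Rightarrow> (nat \<Rightarrow> bool) \<Rightarrow> facet \<Rightarrow> bool" where
  "in_pattern d a b (Dom k) = d k"
| "in_pattern d a b (Lam k) = a k"
| "in_pattern d a b (Mu k) = b k"

lemma ball_facets:
  "(\<forall>c\<in>facets r. Q c) \<longleftrightarrow> (\<forall>k. 1 \<le> k \<and> k \<le> r \<longrightarrow> Q (Dom k) \<and> Q (Lam k) \<and> Q (Mu k))"
  by (auto simp: facets_def)

text \<open>Where \<open>D\<^sub>k = 0\<close>, the second difference reads \<open>b\<^sub>k =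
  a\<^sub>k + D\<^sub>k\<^sub>-\<^sub>1 + D\<^sub>k\<^sub>+\<^sub>1\<close>. A run without positive
  \<open>a\<close> would make \<open>D\<close> convex, hence nondecreasing after its first positive
  step, against \<open>D\<^sub>r = 0\<close>.\<close>

lemma valid_pattern_ineq_cone:
  assumes x: "x \<in> ineq_cone r"
  shows "valid_pattern r (\<lambda>k. surplus r x k > 0) (\<lambda>k. facet_fun r (Lam k) x > 0)
           (\<lambda>k. facet_fun r (Mu k) x > 0)"
proof -
  note nn = ineq_coneD[OF x]
  have beyond: "\<not> surplus r x k > 0" if "k \<ge> r" for k
    using surplus_beyond[of x r k] x that by (simp add: ineq_cone_def)
  have mu: "facet_fun r (Mu k) x > 0 \<longleftrightarrow>
      facet_fun r (Lam k) x > 0 \<or> surplus r x (k - 1) > 0 \<or> surplus r x (k + 1) > 0"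
    if k: "1 \<le> k" "k \<le> r" "\<not> surplus r x k > 0" for k
  proof -
    have "facet_fun r (Mu k) x = facet_fun r (Lam k) x + surplus r x (k - 1) + surplus r x (k + 1)"
      using second_difference[OF k(1), of r x] nn(1)[of k] k(3) by linarith
    then show ?thesis
      using nn(1)[of "k - 1"] nn(1)[of "k + 1"] nn(2)[OF k(1,2)] by linarith
  qed
  have run: "\<exists>m>i. m \<le> r \<and> facet_fun r (Lam m) x > 0 \<and> (\<forall>j. i < j \<and> j \<le> m \<longrightarrow> surplus r x j > 0)"
    if i: "i < r" "\<not> surplus r x i > 0" "surplus r x (Suc i) > 0" for i
  proof (rule ccontr)
    assume no: "\<not> ?thesis"
    have "surplus r x (Suc (i + n)) \<ge> surplus r x (i + n) \<and> (\<forall>j. i < j \<and> j \<le> Suc (i + n) \<longrightarrow> surplus r x j > 0)"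
      if "Suc (i + n) \<le> r" for n
      using that
    proof (induction n)
      case 0
      have "j = Suc i" if "i < j" "j \<le> Suc i" for j using that by simp
      then show ?case using i nn(1)[of i] by fastforce
    next
      case (Suc n)
      let ?m = "Suc (i + n)"
      from Suc have IH: "surplus r x ?m \<ge> surplus r x (i + n)"
        "\<And>j. i < j \<Longrightarrow> j \<le> ?m \<Longrightarrow> surplus r x j > 0" by auto
      have "\<not> facet_fun r (Lam ?m) x > 0"
        using no IH(2) Suc.prems by (metis Suc_leD add_Suc_right less_Suc_eq_le le_add1)
      then have "surplus r x (Suc ?m) \<ge> surplus r x ?m"
        using second_difference[of ?m r x] nn(3)[of ?m] IH(1) Suc.prems by simp
      moreover have "surplus r x ?m > 0" using IH(2) by simp
      ultimately have "surplus r x (Suc ?m) > 0" "surplus r x (Suc ?m) \<ge> surplus r x ?m" by auto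
      moreover have "j = Suc ?m" if "j \<le> Suc ?m" "\<not> j \<le> ?m" for j using that by simp
      ultimately show ?case
        using IH(2) by (metis add_Suc_right)
    qed
    from this[of "r - i - 1"] have "surplus r x r > 0" using i(1) by simp
    then show False using beyond by simp
  qed
  show ?thesis
    unfolding valid_pattern_def
    using beyond mu run by simp
qed

lemma valid_pattern_run:
  assumes v: "valid_pattern r d a b" and k: "d k"
  obtains i m j where "i < k" "k < j" "j \<le> r" "i < m" "m < j" "\<not> d i" "\<not> d j"
    "\<And>l. i < l \<Longrightarrow> l < j \<Longrightarrow> d l" "a m"
proof -
  have "\<not> d 0" and beyond: "\<And>k. k \<ge> r \<Longrightarrow> \<not> d k" using v by (auto simp: valid_pattern_def)
  have "d k \<Longrightarrow> \<exists>i<k. \<not> d i \<and> (\<forall>l. i < l \<and> l \<le> k \<longrightarrow> d l)"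
  proof (induction k)
    case (Suc k)
    show ?case
    proof (cases "d k")
      case True
      then obtain i where "i < k" "\<not> d i" "\<forall>l. i < l \<and> l \<le> k \<longrightarrow> d l" using Suc by blast
      then show ?thesis using Suc.prems by (intro exI[of _ i]) (auto simp: le_Suc_eq)
    next
      case False
      then show ?thesis using Suc.prems by (intro exI[of _ k]) (auto simp: le_Suc_eq)
    qed
  qed (use \<open>\<not> d 0\<close> in simp)
  then obtain i where i: "i < k" "\<not> d i" "\<And>l. i < l \<Longrightarrow> l \<le> k \<Longrightarrow> d l" using k by blast
  have "k < r" using beyond k by (meson not_le)
  \<comment> \<open>The right end of the run; it exists because \<open>d r\<close> is false.\<close>
  define j where "j = (LEAST j. k < j \<and> \<not> d j)"
  have ex: "k < r \<and> \<not> d r" using \<open>k < r\<close> beyond by simp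
  have j: "k < j" "\<not> d j" "j \<le> r"
    unfolding j_def using LeastI[of "\<lambda>j. k < j \<and> \<not> d j", OF ex] Least_le[of "\<lambda>j. k < j \<and> \<not> d j", OF ex]
    by auto
  have kj: "d l" if "k < l" "l < j" for l
    using not_less_Least[of l "\<lambda>j. k < j \<and> \<not> d j"] that by (auto simp: j_def)
  have ij: "d l" if "i < l" "l < j" for l
    using that i(3)[of l] kj[of l] by (cases "l \<le> k") auto
  have "d (Suc i)" "i < r" using i(1,3) \<open>k < r\<close> by auto
  then obtain m where m: "m > i" "a m" "\<forall>l. i < l \<and> l \<le> m \<longrightarrow> d l"
    using v i(2) unfolding valid_pattern_def by blast
  have "m < j" using m(3) j(1,2) i(1) by (metis less_trans not_le)
  then show ?thesis using that[of i j m] i j m ij by blast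
qed

section \<open>Lattice points and tents\<close>

definition lattice_points :: "nat \<Rightarrow> (nat \<Rightarrow>\<^sub>0 real) set" where
  "lattice_points r = {kostka_point la mu | la mu n. la \<in> Par r n \<and> mu \<in> Par r n \<and> dominates la mu}"

lemma parts_kostka_point:
  assumes "length la = r" "length mu = r"
  shows "lambda_part r (kostka_point la mu) i = (if i < r then real (la ! i) else 0)"
    and "mu_part r (kostka_point la mu) i = (if i < r then real (mu ! i) else 0)"
    and "kostka_point la mu \<in> coord_space (2 * r)"
  using assms
  by (auto simp: lambda_part_def mu_part_def kostka_point_def coord_space_def nth_default_def nth_append)

lemma sum_list_take_eq_sum: "k \<le> length xs \<Longrightarrow> sum_list (take k xs) = (\<Sum>i<k. xs ! i :: nat)"
  by (simp add: sum_list_sum_nth atLeast0LessThan)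

lemma surplus_kostka_point:
  assumes "length la = r" "length mu = r" "k \<le> r"
  shows "surplus r (kostka_point la mu) k = real (sum_list (take k la)) - real (sum_list (take k mu))"
  using assms
  by (simp add: surplus_def parts_kostka_point sum_list_take_eq_sum sum_subtractf)

lemma lattice_points_subset_ineq_cone: "lattice_points r \<subseteq> ineq_cone r"
proof
  fix x assume "x \<in> lattice_points r"
  then obtain la mu n where x: "x = kostka_point la mu" and la: "la \<in> Par r n" and mu: "mu \<in> Par r n"
    and dom: "dominates la mu"
    unfolding lattice_points_def by blast
  have len: "length la = r" "length mu = r" and srt: "sorted_wrt (\<ge>) la" "sorted_wrt (\<ge>) mu"
    and sum: "sum_list la = n" "sum_list mu = n"
    using la mu by (auto simp: Par_def)
  have "surplus r x r = 0"
    using surplus_kostka_point[OF len, of r] len sum by (simp add: x)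
  then have "x \<in> kostka_space r"
    using parts_kostka_point(3)[OF len] by (simp add: kostka_space_def x)
  moreover have "facet_fun r (Dom k) x \<ge> 0 \<and> facet_fun r (Lam k) x \<ge> 0 \<and> facet_fun r (Mu k) x \<ge> 0"
    if k: "1 \<le> k" "k \<le> r" for k
  proof -
    have "la ! (k - 1) \<ge> la ! k" "mu ! (k - 1) \<ge> mu ! k" if "k < r"
      using srt len k(1) that by (auto simp: sorted_wrt_iff_nth_less)
    moreover have "k - 1 < r" using k by simp
    ultimately have "facet_fun r (Lam k) x \<ge> 0 \<and> facet_fun r (Mu k) x \<ge> 0"
      by (simp add: x parts_kostka_point[OF len])
    moreover have "surplus r x k \<ge> 0"
      using dom k len by (auto simp: x surplus_kostka_point[OF len] dominates_def)
    ultimately show ?thesis by simp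
  qed
  ultimately show "x \<in> ineq_cone r"
    by (simp add: ineq_cone_def ball_facets)
qed

text \<open>The extremal rays: \<open>\<lambda> = (p + q)\<omega>\<^sub>k\<close> and \<open>\<mu> = p\<omega>\<^sub>i + q\<omega>\<^sub>j\<close>, where \<open>\<omega>\<^sub>k\<close> is the partition with
  \<open>k\<close> parts equal to 1. For \<open>i < k < j\<close>, \<open>p = j - k\<close>, \<open>q = k - i\<close> the graph of \<open>D\<close> is a tent over \<open>[i, j]\<close>
  with apex at \<open>k\<close>; for \<open>i = k = j\<close>, \<open>p = 1\<close>, \<open>q = 0\<close> it is zero.\<close>

definition ray :: "nat \<Rightarrow> nat \<Rightarrow> nat \<Rightarrow> nat \<Rightarrow> nat \<Rightarrow> nat \<Rightarrow> nat \<Rightarrow>\<^sub>0 real" where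
  "ray r p q i k j = kostka_point (map (\<lambda>l. if l < k then p + q else 0) [0..<r])
     (map (\<lambda>l. (if l < i then p else 0) + (if l < j then q else 0)) [0..<r])"

lemma sum_step: "(\<Sum>l<m. if l < k then c else (0::nat)) = c * min m k"
  by (induction m) (auto simp: min_def)

text \<open>The hypothesis makes \<open>k\<close> the mean of \<open>i\<close> and \<open>j\<close>
  with weights \<open>p\<close> and \<open>q\<close>; the inequality is then Jensen's for the
  concave function \<open>min m\<close>. It yields dominance, the equation yields equal
  sums.\<close>

lemma ray_balance:
  fixes p q i j k m :: nat
  assumes "i \<le> k" "k \<le> j" "p * (k - i) = q * (j - k)"
  shows "p * min m i + q * min m j \<le> (p + q) * min m k"
    and "p * i + q * j = (p + q) * k"
proof -
  obtain s where s: "k = i + s" using assms(1) le_Suc_ex by blast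
  obtain t where t: "j = k + t" using assms(2) le_Suc_ex by blast
  have e: "p * s = q * t" using assms(3) by (simp add: s t)
  show "p * i + q * j = (p + q) * k" using e by (simp add: s t algebra_simps)
  consider "m \<le> i" | "i \<le> m" "m \<le> k" | "k \<le> m" "m \<le> j" | "j \<le> m" by linarith
  then show "p * min m i + q * min m j \<le> (p + q) * min m k"
  proof cases
    case 1
    then show ?thesis using assms by (simp add: min_def algebra_simps)
  next
    case 2
    then have "p * i \<le> p * m" by simp
    then show ?thesis using 2 assms by (simp add: min_def algebra_simps)
  next
    case 3
    then obtain w where w: "m = k + w" using le_Suc_ex by blast
    then have "q * w \<le> q * t" using 3 t by simp
    then have "p * i + q * m \<le> (p + q) * k"
      using e by (simp add: w s algebra_simps)
    then show ?thesis using 3 assms by (cases "m = k"; cases "m = j"; cases "m = i") (auto simp: min_def)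
  next
    case 4
    then have "min m i = i" "min m j = j" "min m k = k" using assms by auto
    then show ?thesis using \<open>p * i + q * j = (p + q) * k\<close> by simp
  qed
qed

lemma ray_in_lattice_points:
  assumes "i \<le> k" "k \<le> j" "j \<le> r" "p * (k - i) = q * (j - k)"
  shows "ray r p q i k j \<in> lattice_points r"
proof -
  define la where "la = map (\<lambda>l. if l < k then p + q else 0) [0..<r]"
  define mu where "mu = map (\<lambda>l. (if l < i then p else 0) + (if l < j then q else 0)) [0..<r]"
  have len: "length la = r" "length mu = r" by (auto simp: la_def mu_def)
  have la_take: "sum_list (take m la) = (p + q) * min m k" if "m \<le> r" for m
  proof -
    have "sum_list (take m la) = (\<Sum>l<m. if l < k then p + q else 0)"
      using that len by (subst sum_list_take_eq_sum) (auto simp: la_def intro!: sum.cong)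
    then show ?thesis by (simp only: sum_step)
  qed
  have mu_take: "sum_list (take m mu) = p * min m i + q * min m j" if "m \<le> r" for m
  proof -
    have "sum_list (take m mu) = (\<Sum>l<m. (if l < i then p else 0) + (if l < j then q else 0))"
      using that len by (subst sum_list_take_eq_sum) (auto simp: mu_def intro!: sum.cong)
    then show ?thesis by (simp only: sum.distrib sum_step)
  qed
  have "sum_list la = (p + q) * k" "sum_list mu = (p + q) * k"
    using la_take[of r] mu_take[of r] len assms ray_balance(2)[OF assms(1,2,4)] by auto
  moreover have "sorted_wrt (\<ge>) la" "sorted_wrt (\<ge>) mu"
    by (auto simp: la_def mu_def sorted_wrt_iff_nth_less)
  ultimately have "la \<in> Par r ((p + q) * k)" "mu \<in> Par r ((p + q) * k)"
    using len by (auto simp: Par_def)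
  moreover have "dominates la mu"
    using len la_take mu_take ray_balance(1)[OF assms(1,2,4)] by (auto simp: dominates_def)
  ultimately show ?thesis
    unfolding lattice_points_def ray_def la_def[symmetric] mu_def[symmetric] by blast
qed

lemma facet_fun_ray:
  assumes "i \<le> k" "k \<le> j" "j \<le> r"
  shows "1 \<le> m \<Longrightarrow> facet_fun r (Lam m) (ray r p q i k j) = (if m = k then real (p + q) else 0)"
    and "1 \<le> m \<Longrightarrow> facet_fun r (Mu m) (ray r p q i k j) = (if m = i then real p else 0) + (if m = j then real q else 0)"
    and "m \<le> r \<Longrightarrow> surplus r (ray r p q i k j) m =
      real ((p + q) * min m k) - real (p * min m i + q * min m j)"
proof -
  have L: "lambda_part r (ray r p q i k j) l = (if l < k then real (p + q) else 0)" for l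
    using assms by (auto simp: ray_def parts_kostka_point)
  have M: "mu_part r (ray r p q i k j) l = (if l < i then real p else 0) + (if l < j then real q else 0)" for l
    using assms by (auto simp: ray_def parts_kostka_point)
  show "1 \<le> m \<Longrightarrow> facet_fun r (Lam m) (ray r p q i k j) = (if m = k then real (p + q) else 0)"
    by (auto simp: L)
  show "1 \<le> m \<Longrightarrow> facet_fun r (Mu m) (ray r p q i k j) = (if m = i then real p else 0) + (if m = j then real q else 0)"
    by (auto simp: M)
  have S: "(\<Sum>l<m. if l < k then c else 0) = c * real (min m k)" for m k and c :: real
    by (induction m) (auto simp: min_def algebra_simps)
  show "surplus r (ray r p q i k j) m = real ((p + q) * min m k) - real (p * min m i + q * min m j)"
    unfolding surplus_def L M sum_subtractf sum.distrib S by simp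
qed

text \<open>With \<open>s = m - i\<close> and \<open>t = j - m\<close>, the tent has height
  \<open>t * u\<close> at \<open>i + u\<close> on the rising side and \<open>s * u\<close> at
  distance \<open>u\<close> from \<open>j\<close> on the falling side.\<close>

lemma surplus_tent_pos_iff:
  assumes "i < m" "m < j" "j \<le> r" "l \<le> r"
  shows "surplus r (ray r (j - m) (m - i) i m j) l > 0 \<longleftrightarrow> i < l \<and> l < j"
proof -
  define s t where "s = m - i" and "t = j - m"
  have st: "m = i + s" "j = i + s + t" "s > 0" "t > 0" using assms by (auto simp: s_def t_def)
  have D: "surplus r (ray r t s i m j) l =
      (real t + real s) * real (min l m) - (real t * real (min l i) + real s * real (min l j))"
    using facet_fun_ray(3)[of i m j r l t s] assms by simp
  consider "l \<le> i" | u where "l = i + u" "0 < u" "u \<le> s" | u where "l + u = j" "0 < u" "u < t" | "j \<le> l"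
  proof -
    consider "l \<le> i" | "i < l" "l \<le> m" | "m < l" "l < j" | "j \<le> l" by linarith
    then show ?thesis
    proof cases
      case 2
      then show ?thesis using that(2)[of "l - i"] st by auto
    next
      case 3
      then show ?thesis using that(3)[of "j - l"] st by auto
    qed (use that in auto)
  qed
  then have "surplus r (ray r t s i m j) l > 0 \<longleftrightarrow> i < l \<and> l < j"
  proof cases
    case 1
    then have "min l m = l" "min l i = l" "min l j = l" using st by auto
    then show ?thesis using 1 by (simp add: D algebra_simps)
  next
    case (2 u)
    then have "min l m = l" "min l i = i" "min l j = l" using st by auto
    then have "surplus r (ray r t s i m j) l = (real t + real s) * real l - (real t * real i + real s * real l)"
      by (simp only: D)
    then have "surplus r (ray r t s i m j) l = real t * real u"
      using 2 by (simp add: algebra_simps)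
    then show ?thesis using 2 st by simp
  next
    case (3 u)
    then have "min l m = m" "min l i = i" "min l j = l" using st by auto
    then have "surplus r (ray r t s i m j) l = (real t + real s) * real m - (real t * real i + real s * real l)"
      by (simp only: D)
    moreover have "real l = real i + real s + real t - real u" "real m = real i + real s"
      using 3 st by linarith+
    ultimately have "surplus r (ray r t s i m j) l =
        (real t + real s) * (real i + real s) - (real t * real i + real s * (real i + real s + real t - real u))"
      by (simp only:)
    then have "surplus r (ray r t s i m j) l = real s * real u"
      by (simp add: algebra_simps)
    then show ?thesis using 3 st by auto
  next
    case 4
    then have "min l m = m" "min l i = i" "min l j = j" using st by auto
    then have "surplus r (ray r t s i m j) l = (real t + real s) * real m - (real t * real i + real s * real j)"
      by (simp only: D)
    then have "surplus r (ray r t s i m j) l = 0"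
      by (simp add: st(1,2) algebra_simps)
    then show ?thesis using 4 by simp
  qed
  then show ?thesis by (simp add: s_def t_def)
qed

text \<open>Such points are added up to realise a pattern, and subtracted to decompose a point of
  the cone.\<close>

definition compatible :: "nat \<Rightarrow> (facet \<Rightarrow> bool) \<Rightarrow> (nat \<Rightarrow>\<^sub>0 real) \<Rightarrow> bool" where
  "compatible r Q z \<longleftrightarrow> z \<in> lattice_points r \<and> (\<forall>c\<in>facets r. facet_fun r c z > 0 \<longrightarrow> Q c)"

lemma compatible_tent:
  assumes "i < m" "m < j" "j \<le> r"
    and "\<And>l. i < l \<Longrightarrow> l < j \<Longrightarrow> d l" "a m" "1 \<le> i \<Longrightarrow> b i" "b j"
  shows "compatible r (in_pattern d a b) (ray r (j - m) (m - i) i m j)"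
  unfolding compatible_def ball_facets
  using assms ray_in_lattice_points[of i m j r "j - m" "m - i"]
  by (auto simp: surplus_tent_pos_iff facet_fun_ray(1,2) simp del: facet_fun.simps(2,3) split: if_splits)

lemma compatible_flat:
  assumes "1 \<le> k" "k \<le> r" "a k" "b k"
  shows "compatible r (in_pattern d a b) (ray r 1 0 k k k)"
  unfolding compatible_def ball_facets
  using assms ray_in_lattice_points[of k k k r 1 0]
  by (auto simp: facet_fun_ray simp del: facet_fun.simps(2,3) split: if_splits)

lemma tent_facets_pos:
  assumes "i < m" "m < j" "j \<le> r"
  shows "facet_fun r (Lam m) (ray r (j - m) (m - i) i m j) > 0"
    and "1 \<le> i \<Longrightarrow> facet_fun r (Mu i) (ray r (j - m) (m - i) i m j) > 0"
    and "facet_fun r (Mu j) (ray r (j - m) (m - i) i m j) > 0"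
  using assms facet_fun_ray[of i m j r] by (simp_all del: facet_fun.simps)

lemma flat_facets_pos:
  assumes "1 \<le> k" "k \<le> r"
  shows "facet_fun r (Lam k) (ray r 1 0 k k k) > 0" and "facet_fun r (Mu k) (ray r 1 0 k k k) > 0"
  using assms facet_fun_ray[of k k k r] by (simp_all del: facet_fun.simps)

text \<open>A positive \<open>D\<^sub>k\<close> is met by a tent over its whole run with apex where
  \<open>a\<close> is positive, a positive \<open>a\<^sub>k\<close> in a run by the tent with apex
  \<open>k\<close>, and positive \<open>a\<^sub>k\<close> and \<open>b\<^sub>k\<close> together by a
  flat ray. A positive \<open>b\<^sub>k\<close> without \<open>a\<^sub>k\<close> needs a tent with
  one foot at \<open>k\<close>: inside a run it spans the part from \<open>k\<close> to the far end
  beyond the apex, at a zero of \<open>D\<close> it spans the neighbouring run.\<close>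

lemma pattern_covered:
  assumes v: "valid_pattern r d a b" and c: "c \<in> facets r" "in_pattern d a b c"
  shows "\<exists>z. compatible r (in_pattern d a b) z \<and> facet_fun r c z > 0"
proof -
  have bound: "b k \<longleftrightarrow> a k \<or> d (k - 1) \<or> d (k + 1)" if "1 \<le> k" "k \<le> r" "\<not> d k" for k
    using v that by (auto simp: valid_pattern_def)
  have run: "\<exists>i m j. i < k \<and> k < j \<and> j \<le> r \<and> i < m \<and> m < j \<and> \<not> d i \<and> \<not> d j \<and>
      (\<forall>l. i < l \<and> l < j \<longrightarrow> d l) \<and> a m \<and> (1 \<le> i \<longrightarrow> b i) \<and> b j" if k: "d k" for k
  proof -
    obtain i m j where *: "i < k" "k < j" "j \<le> r" "i < m" "m < j" "\<not> d i" "\<not> d j"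
      "\<And>l. i < l \<Longrightarrow> l < j \<Longrightarrow> d l" "a m"
      using valid_pattern_run[OF v k] by metis
    \<comment> \<open>The ends of the run are zeros with a positive neighbour, so the pattern
      permits the feet of a tent there.\<close>
    have "d (i + 1)" "d (j - 1)" using *(1,2) *(8)[of "i + 1"] *(8)[of "j - 1"] by auto
    then have "1 \<le> i \<longrightarrow> b i" "b j"
      using bound[of i] bound[of j] * by auto
    then show ?thesis using * by blast
  qed
  consider (D) k where "c = Dom k" "1 \<le> k" "k \<le> r" "d k"
    | (A) k where "c = Lam k" "1 \<le> k" "k \<le> r" "a k" "d k"
    | (AB) k where "c = Lam k \<or> c = Mu k" "1 \<le> k" "k \<le> r" "a k" "b k"
    | (B) k where "c = Mu k" "1 \<le> k" "k \<le> r" "b k" "\<not> a k" "d k"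
    | (B') k where "c = Mu k" "1 \<le> k" "k \<le> r" "b k" "\<not> a k" "\<not> d k"
  proof -
    obtain k where k: "1 \<le> k" "k \<le> r" "c = Dom k \<or> c = Lam k \<or> c = Mu k"
      using c(1) by (auto simp: facets_def)
    have ab: "a k \<Longrightarrow> \<not> d k \<Longrightarrow> b k" using bound[of k] k by auto
    from k(3) show ?thesis
    proof (elim disjE)
      assume "c = Dom k"
      then show ?thesis using that(1)[of k] k c(2) by simp
    next
      assume "c = Lam k"
      then show ?thesis using that(2,3)[of k] k(1,2) c(2) ab by (cases "d k") simp_all
    next
      assume cM: "c = Mu k"
      then have bk: "b k" using c(2) by simp
      show ?thesis
      proof (cases "a k")
        case True
        show ?thesis by (rule that(3)[of k]) (use cM k bk True in auto)
      next
        case False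
        show ?thesis
        proof (cases "d k")
          case True
          show ?thesis by (rule that(4)[of k]) fact+
        next
          case d: False
          show ?thesis by (rule that(5)[of k]) fact+
        qed
      qed
    qed
  qed
  then show ?thesis
  proof cases
    case D
    obtain i m j where *: "i < k" "k < j" "j \<le> r" "i < m" "m < j"
      "\<forall>l. i < l \<and> l < j \<longrightarrow> d l" "a m" "1 \<le> i \<longrightarrow> b i" "b j"
      using run[OF D(4)] by blast
    have "compatible r (in_pattern d a b) (ray r (j - m) (m - i) i m j)"
      using * by (intro compatible_tent) auto
    moreover have "facet_fun r c (ray r (j - m) (m - i) i m j) > 0"
      using * D surplus_tent_pos_iff[of i m j r k] by simp
    ultimately show ?thesis by blast
  next
    case A
    obtain i m j where *: "i < k" "k < j" "j \<le> r" "\<forall>l. i < l \<and> l < j \<longrightarrow> d l" "1 \<le> i \<longrightarrow> b i" "b j"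
      using run[OF A(5)] by blast
    have "compatible r (in_pattern d a b) (ray r (j - k) (k - i) i k j)"
      using * A by (intro compatible_tent) auto
    moreover have "facet_fun r c (ray r (j - k) (k - i) i k j) > 0"
      unfolding A(1) using * by (intro tent_facets_pos)
    ultimately show ?thesis by blast
  next
    case AB
    have "compatible r (in_pattern d a b) (ray r 1 0 k k k)"
      using AB by (intro compatible_flat)
    moreover have "facet_fun r c (ray r 1 0 k k k) > 0"
      using AB flat_facets_pos[of k r] by metis
    ultimately show ?thesis by blast
  next
    case B
    obtain i m j where *: "i < k" "k < j" "j \<le> r" "i < m" "m < j"
      "\<forall>l. i < l \<and> l < j \<longrightarrow> d l" "a m" "1 \<le> i \<longrightarrow> b i" "b j"
      using run[OF B(6)] by blast
    have "m \<noteq> k" using B * by auto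
    then consider "k < m" | "m < k" by linarith
    then show ?thesis
    proof cases
      case 1
      have "compatible r (in_pattern d a b) (ray r (j - m) (m - k) k m j)"
        using * B 1 by (intro compatible_tent) auto
      moreover have "facet_fun r c (ray r (j - m) (m - k) k m j) > 0"
        unfolding B(1) using * B 1 by (intro tent_facets_pos)
      ultimately show ?thesis by blast
    next
      case 2
      have "compatible r (in_pattern d a b) (ray r (k - m) (m - i) i m k)"
        using * B 2 by (intro compatible_tent) auto
      moreover have "facet_fun r c (ray r (k - m) (m - i) i m k) > 0"
        unfolding B(1) using * B 2 by (intro tent_facets_pos)
      ultimately show ?thesis by blast
    qed
  next
    case B'
    then have "d (k - 1) \<or> d (k + 1)" using bound[of k] by auto
    then show ?thesis
    proof
      assume "d (k - 1)"
      then obtain i m j where *: "i < k - 1" "k - 1 < j" "j \<le> r" "i < m" "m < j"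
        "\<forall>l. i < l \<and> l < j \<longrightarrow> d l" "a m" "1 \<le> i \<longrightarrow> b i" "b j"
        using run by blast
      \<comment> \<open>The zero \<open>k\<close> cannot lie inside the run through
        \<open>k - 1\<close>, so that run ends exactly at \<open>k\<close>.\<close>
      have "j = k"
      proof (rule ccontr)
        assume "j \<noteq> k"
        then have "i < k" "k < j" using * by auto
        then show False using * B' by blast
      qed
      have "compatible r (in_pattern d a b) (ray r (j - m) (m - i) i m j)"
        using * by (intro compatible_tent) auto
      moreover have "facet_fun r c (ray r (j - m) (m - i) i m j) > 0"
        unfolding B'(1) \<open>j = k\<close>[symmetric] using * by (intro tent_facets_pos)
      ultimately show ?thesis by blast
    next
      assume "d (k + 1)"
      then obtain i m j where *: "i < k + 1" "k + 1 < j" "j \<le> r" "i < m" "m < j"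
        "\<forall>l. i < l \<and> l < j \<longrightarrow> d l" "a m" "1 \<le> i \<longrightarrow> b i" "b j"
        using run by blast
      have "i = k"
      proof (rule ccontr)
        assume "i \<noteq> k"
        then have "i < k" "k < j" using * by auto
        then show False using * B' by blast
      qed
      have "compatible r (in_pattern d a b) (ray r (j - m) (m - i) i m j)"
        using * by (intro compatible_tent) auto
      moreover have "facet_fun r c (ray r (j - m) (m - i) i m j) > 0"
        unfolding B'(1) \<open>i = k\<close>[symmetric] using * \<open>i = k\<close> B' by (intro tent_facets_pos) auto
      ultimately show ?thesis by blast
    qed
  qed
qed

text \<open>Add one compatible point for each entry of the pattern: all functionals are nonnegative
  on the summands, so nothing cancels.\<close>

lemma pattern_realized:
  assumes v: "valid_pattern r d a b"
  shows "\<exists>x\<in>ineq_cone r. \<forall>c\<in>facets r. facet_fun r c x > 0 \<longleftrightarrow> in_pattern d a b c"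
proof -
  define N where "N = {c \<in> facets r. in_pattern d a b c}"
  have finN: "finite N" by (simp add: N_def finite_facets)
  have "\<forall>c\<in>N. \<exists>z. compatible r (in_pattern d a b) z \<and> facet_fun r c z > 0"
    using pattern_covered[OF v] by (auto simp: N_def)
  then obtain z where z: "\<And>c. c \<in> N \<Longrightarrow> compatible r (in_pattern d a b) (z c) \<and> facet_fun r c (z c) > 0"
    by metis
  have zc: "z c \<in> ineq_cone r" if "c \<in> N" for c
    using z[OF that] lattice_points_subset_ineq_cone by (auto simp: compatible_def)
  have nn: "facet_fun r c (z c') \<ge> 0" if "c \<in> facets r" "c' \<in> N" for c c'
    using zc[OF that(2)] that(1) by (simp add: ineq_cone_def)
  define x where "x = (\<Sum>c\<in>N. z c)"
  have fx: "facet_fun r c x = (\<Sum>c'\<in>N. facet_fun r c (z c'))" for c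
    by (simp add: x_def linear_sum linear_facet_fun)
  have "x \<in> kostka_space r"
    unfolding x_def using zc by (intro subspace_sum subspace_kostka_space) (auto simp: ineq_cone_def)
  then have "x \<in> ineq_cone r"
    using nn by (auto simp: ineq_cone_def fx intro: sum_nonneg)
  moreover have "facet_fun r c x > 0 \<longleftrightarrow> in_pattern d a b c" if c: "c \<in> facets r" for c
  proof
    assume "in_pattern d a b c"
    then have "c \<in> N" using c by (simp add: N_def)
    then show "facet_fun r c x > 0"
      unfolding fx using z nn[OF c] finN by (intro sum_pos2[of N c]) auto
  next
    assume "facet_fun r c x > 0"
    then obtain c' where c': "c' \<in> N" "facet_fun r c (z c') > 0"
      unfolding fx by (metis not_less sum_nonpos)
    then show "in_pattern d a b c" using z[OF c'(1)] c by (auto simp: compatible_def)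
  qed
  ultimately show ?thesis by blast
qed

section \<open>The convex hull as the cone of all inequalities\<close>

lemma scaleR_kostka_point:
  "real n *\<^sub>R kostka_point la mu = kostka_point (map ((*) n) la) (map ((*) n) mu)"
  by (rule poly_mapping_eqI) (auto simp: kostka_point_def nth_default_def nth_append)

lemma lattice_points_scale: "x \<in> lattice_points r \<Longrightarrow> real n *\<^sub>R x \<in> lattice_points r"
proof -
  assume "x \<in> lattice_points r"
  then obtain la mu m where x: "x = kostka_point la mu" and p: "la \<in> Par r m" "mu \<in> Par r m" "dominates la mu"
    unfolding lattice_points_def by blast
  have "map ((*) n) la \<in> Par r (n * m)" "map ((*) n) mu \<in> Par r (n * m)"
    using p by (auto simp: Par_def sorted_wrt_map sum_list_const_mult elim!: sorted_wrt_mono_rel[rotated])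
  moreover have "dominates (map ((*) n) la) (map ((*) n) mu)"
    using p by (auto simp: dominates_def take_map sum_list_const_mult)
  ultimately show ?thesis
    unfolding lattice_points_def x scaleR_kostka_point by blast
qed

lemma zero_in_lattice_points: "0 \<in> lattice_points r"
  using lattice_points_scale[of _ r 0] ray_in_lattice_points[of 0 0 0 r 0 0] by fastforce

lemma kostka_cone_eq_hull: "kostka_cone r = convex hull lattice_points r"
  by (simp add: kostka_cone_def lattice_points_def)

text \<open>The lattice points are closed under natural multiples. Hence
  \<open>t *\<^sub>R x\<close> lies between 0 and a large multiple of \<open>x\<close>, and
  \<open>x + y\<close> is the midpoint of the doubled points.\<close>

lemma kostka_cone_scale_add:
  assumes x: "x \<in> kostka_cone r"
  shows "t \<ge> 0 \<Longrightarrow> t *\<^sub>R x \<in> kostka_cone r"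
    and "y \<in> kostka_cone r \<Longrightarrow> x + y \<in> kostka_cone r"
proof -
  have cvx: "convex (kostka_cone r)" by (simp add: kostka_cone_eq_hull)
  have 0: "0 \<in> kostka_cone r"
    by (simp add: kostka_cone_eq_hull hull_inc zero_in_lattice_points)
  have nat: "real n *\<^sub>R z \<in> kostka_cone r" if "z \<in> kostka_cone r" for n z
  proof -
    have "real n *\<^sub>R z \<in> convex hull ((\<lambda>z. real n *\<^sub>R z) ` lattice_points r)"
      using that by (auto simp: convex_hull_scaling kostka_cone_eq_hull)
    also have "\<dots> \<subseteq> kostka_cone r"
      unfolding kostka_cone_eq_hull by (intro hull_mono) (auto simp: lattice_points_scale)
    finally show ?thesis .
  qed
  show "t *\<^sub>R x \<in> kostka_cone r" if t: "t \<ge> 0"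
  proof -
    obtain n :: nat where n: "t < real n" using reals_Archimedean2 by blast
    have "(1 - t / real n) *\<^sub>R 0 + (t / real n) *\<^sub>R (real n *\<^sub>R x) \<in> kostka_cone r"
      using n t by (intro convexD[OF cvx 0 nat[OF x]]) (auto simp: field_simps)
    then show ?thesis using n t by simp
  qed
  show "x + y \<in> kostka_cone r" if y: "y \<in> kostka_cone r"
  proof -
    have "(1/2) *\<^sub>R (real 2 *\<^sub>R x) + (1/2) *\<^sub>R (real 2 *\<^sub>R y) \<in> kostka_cone r"
      by (intro convexD[OF cvx nat[OF x] nat[OF y]]) auto
    then show ?thesis by simp
  qed
qed

lemma ineq_cone_eq_0:
  assumes "x \<in> ineq_cone r" "\<And>c. c \<in> facets r \<Longrightarrow> facet_fun r c x = 0"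
  shows "x = 0"
proof (rule coord_space_eq_0I[of x r])
  show "x \<in> coord_space (2 * r)" using assms(1) by (simp add: ineq_cone_def kostka_space_def)
  have "facet_fun r (Lam k) x = 0" "facet_fun r (Mu k) x = 0" if "1 \<le> k" "k \<le> r" for k
    using assms(2)[of "Lam k"] assms(2)[of "Mu k"] that by (auto simp: facets_def)
  then show "i < r \<Longrightarrow> lambda_part r x i = 0" "i < r \<Longrightarrow> mu_part r x i = 0" for i
    using lambda_part_zero[of r x i] mu_part_zero[of r x i] by auto
qed

text \<open>Subtract from a point of the cone the largest possible multiple of a lattice point supported in
  its pattern; this makes a further inequality tight.\<close>

theorem kostka_cone_eq_ineq_cone: "kostka_cone r = ineq_cone r"
proof
  have "convex (ineq_cone r)"
    unfolding convex_def ineq_cone_def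
    using subspace_kostka_space[of r] linear_facet_fun[of r]
    by (auto simp: linear_add linear_scale subspace_add subspace_scale simp del: facet_fun.simps)
  then show "kostka_cone r \<subseteq> ineq_cone r"
    unfolding kostka_cone_eq_hull using lattice_points_subset_ineq_cone by (rule hull_minimal[rotated])
  define supp where "supp x = {c \<in> facets r. facet_fun r c x > 0}" for x
  have fin: "finite (supp x)" for x by (simp add: supp_def finite_facets)
  have "x \<in> ineq_cone r \<Longrightarrow> x \<in> kostka_cone r" for x
  proof (induction "card (supp x)" arbitrary: x rule: less_induct)
    case (less x)
    have xnn: "facet_fun r c x \<ge> 0" if "c \<in> facets r" for c
      using less.prems that by (simp add: ineq_cone_def)
    show ?case
    proof (cases "supp x = {}")
      case True
      then have "facet_fun r c x = 0" if "c \<in> facets r" for c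
        using that xnn[OF that] by (auto simp: supp_def)
      then have "x = 0" using ineq_cone_eq_0[OF less.prems] by blast
      then show ?thesis
        by (simp add: kostka_cone_eq_hull hull_inc zero_in_lattice_points)
    next
      case False
      then obtain c where c: "c \<in> facets r" "facet_fun r c x > 0" by (auto simp: supp_def)
      let ?Q = "in_pattern (\<lambda>k. surplus r x k > 0) (\<lambda>k. facet_fun r (Lam k) x > 0) (\<lambda>k. facet_fun r (Mu k) x > 0)"
      have Q: "?Q c \<longleftrightarrow> facet_fun r c x > 0" for c by (cases c) simp_all
      obtain z where z: "compatible r ?Q z" "facet_fun r c z > 0"
        using pattern_covered[OF valid_pattern_ineq_cone[OF less.prems] c(1)] c(2) Q by blast
      have zl: "z \<in> lattice_points r" and zx: "supp z \<subseteq> supp x"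
        using z(1) Q by (auto simp: compatible_def supp_def simp del: facet_fun.simps)
      have zi: "z \<in> ineq_cone r" using zl lattice_points_subset_ineq_cone by blast
      have "c \<in> supp z" using c z by (simp add: supp_def)
      define t where "t = Min ((\<lambda>c. facet_fun r c x / facet_fun r c z) ` supp z)"
      have t_le: "t \<le> facet_fun r c x / facet_fun r c z" if "c \<in> supp z" for c
        unfolding t_def using that fin by (intro Min_le) auto
      have "t \<in> (\<lambda>c. facet_fun r c x / facet_fun r c z) ` supp z"
        unfolding t_def using fin \<open>c \<in> supp z\<close> by (intro Min_in) auto
      then obtain e where e: "e \<in> supp z" "t = facet_fun r e x / facet_fun r e z" by blast
      have t0: "t \<ge> 0" using e zx by (auto simp: supp_def intro!: divide_nonneg_pos xnn)
      define y where "y = x - t *\<^sub>R z"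
      have fy: "facet_fun r c y = facet_fun r c x - t * facet_fun r c z" for c
        by (simp add: y_def linear_diff linear_scale linear_facet_fun del: facet_fun.simps)
      have z0: "facet_fun r c z = 0" if "c \<in> facets r" "c \<notin> supp z" for c
        using that zi by (force simp: supp_def ineq_cone_def)
      have ynn: "facet_fun r c y \<ge> 0" if cf: "c \<in> facets r" for c
      proof (cases "c \<in> supp z")
        case True
        then have "facet_fun r c z > 0" by (simp add: supp_def)
        then show ?thesis using t_le[OF True] by (simp add: fy pos_le_divide_eq)
      next
        case False
        then show ?thesis using z0[OF cf] xnn[OF cf] by (simp add: fy)
      qed
      have "y \<in> ineq_cone r"
        using less.prems zi ynn subspace_kostka_space[of r]
        by (auto simp: ineq_cone_def y_def subspace_diff subspace_scale simp del: facet_fun.simps)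
      moreover have "supp y \<subseteq> supp x - {e}"
      proof
        fix c assume "c \<in> supp y"
        then have cc: "c \<in> facets r" "facet_fun r c y > 0" by (auto simp: supp_def)
        have "c \<noteq> e" using cc(2) e by (auto simp: fy supp_def)
        moreover have "c \<in> supp x"
        proof (cases "c \<in> supp z")
          case False
          then show ?thesis using cc z0[OF cc(1)] by (auto simp: fy supp_def)
        qed (use zx in blast)
        ultimately show "c \<in> supp x - {e}" by blast
      qed
      then have "card (supp y) < card (supp x)"
        using e(1) zx fin by (intro psubset_card_mono) auto
      ultimately have "y \<in> kostka_cone r" using less.hyps by blast
      moreover have "t *\<^sub>R z \<in> kostka_cone r"
        using kostka_cone_scale_add(1)[OF _ t0] zl by (simp add: kostka_cone_eq_hull hull_inc)
      ultimately have "y + t *\<^sub>R z \<in> kostka_cone r" by (rule kostka_cone_scale_add(2))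
      then show ?thesis by (simp add: y_def)
    qed
  qed
  then show "ineq_cone r \<subseteq> kostka_cone r" by blast
qed

section \<open>Counting words\<close>

text \<open>The coefficient \<open>c\<close> may be 0, so \<open>m\<close> only bounds the degree;
  lower-order terms can be added without tracking their exact degrees.\<close>

definition polynomial_seq :: "(nat \<Rightarrow> real) \<Rightarrow> nat \<Rightarrow> real \<Rightarrow> bool" where
  "polynomial_seq f m c \<longleftrightarrow>
     (\<exists>p. degree p \<le> m \<and> coeff p m = c \<and> (\<forall>n. f n = poly p (real n)))"

lemma polynomial_seq_const: "polynomial_seq (\<lambda>_. c) 0 c"
  unfolding polynomial_seq_def by (intro exI[of _ "[:c:]"]) auto

lemma polynomial_seq_cong:
  "polynomial_seq f m c \<Longrightarrow> (\<And>n. g n = f n) \<Longrightarrow> c = d \<Longrightarrow> polynomial_seq g m d"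
  unfolding polynomial_seq_def by simp

lemma polynomial_seq_add:
  "polynomial_seq f m c \<Longrightarrow> polynomial_seq g m d \<Longrightarrow> polynomial_seq (\<lambda>n. f n + g n) m (c + d)"
  unfolding polynomial_seq_def
  by (elim exE conjE, rule_tac x = "p + pa" in exI) (auto intro: degree_add_le)

lemma polynomial_seq_mono:
  assumes "polynomial_seq f m c" "m < m'"
  shows "polynomial_seq f m' 0"
  using assms unfolding polynomial_seq_def
  by (metis coeff_eq_0 le_less_trans less_imp_le)

text \<open>Discrete integration: removing a suitable top-degree monomial from \<open>f\<close>
  lowers the degree of its difference, so induction applies to the rest.\<close>

lemma polynomial_seq_antidifference:
  assumes "polynomial_seq (\<lambda>n. f (Suc n) - f n) m c"
  shows "polynomial_seq f (Suc m) (c / real (Suc m))"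
  using assms
proof (induction m arbitrary: f c)
  case 0
  then obtain p where p: "degree p \<le> 0" "coeff p 0 = c" "\<And>n. f (Suc n) - f n = poly p (real n)"
    unfolding polynomial_seq_def by blast
  have "p = [:c:]"
    using p(1,2) by (metis degree_0_id le_zero_eq)
  then have step: "f (Suc n) = f n + c" for n
    using p(3)[of n] by simp
  have "f n = poly [:f 0, c:] (real n)" for n
    by (induction n) (auto simp: step algebra_simps)
  then have "\<forall>n. f n = poly [:f 0, c:] (real n)" ..
  moreover have "degree [:f 0, c:] \<le> Suc 0" "coeff [:f 0, c:] (Suc 0) = c / real (Suc 0)"
    by simp_all
  ultimately show ?case
    unfolding polynomial_seq_def by blast
next
  case (Suc m)
  then obtain q where q: "degree q \<le> Suc m" "coeff q (Suc m) = c"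
      "\<And>n. f (Suc n) - f n = poly q (real n)"
    unfolding polynomial_seq_def by blast
  \<comment> \<open>The difference of \<open>n ^ Suc (Suc m)\<close> has leading coefficient
    \<open>Suc (Suc m)\<close>, so this multiple cancels the top coefficient
    \<open>c\<close>.\<close>
  define e where "e = c / real (Suc (Suc m))"
  define g where "g n = f n - e * real n ^ Suc (Suc m)" for n
  define q' where "q' = q - smult e ([:1, 1:] ^ Suc (Suc m) - monom 1 (Suc (Suc m)))"
  have coeff_power: "coeff ([:1, 1:] ^ n) i = real (n choose i)" for n i
    by (cases "i \<le> n") (auto simp: coeff_linear_poly_power coeff_eq_0 degree_linear_power)
  have coeff_q': "coeff q' i = coeff q i - e * (real (Suc (Suc m) choose i) - (if i = Suc (Suc m) then 1 else 0))" for i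
    unfolding q'_def coeff_diff coeff_smult coeff_power by (simp del: binomial_Suc_Suc)
  have "coeff q' i = 0" if "i > m" for i
  proof (cases "i = Suc m")
    case True
    then show ?thesis using q(2) by (simp add: coeff_q' e_def)
  next
    case False
    then have "i > Suc m" using that by simp
    then have "coeff q i = 0" using q(1) by (simp add: coeff_eq_0)
    then show ?thesis using \<open>i > Suc m\<close> by (cases "i = Suc (Suc m)") (auto simp: coeff_q')
  qed
  then have deg: "degree q' \<le> m" by (simp add: degree_le)
  have "g (Suc n) - g n = poly q' (real n)" for n
    using q(3)[of n]
    by (simp add: g_def q'_def poly_monom algebra_simps del: power_Suc)
  then have "polynomial_seq (\<lambda>n. g (Suc n) - g n) m (coeff q' m)"
    unfolding polynomial_seq_def using deg by blast
  then have "polynomial_seq g (Suc m) (coeff q' m / real (Suc m))"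
    by (rule Suc.IH)
  then have 1: "polynomial_seq g (Suc (Suc m)) 0"
    by (rule polynomial_seq_mono) simp
  have 2: "polynomial_seq (\<lambda>n. e * real n ^ Suc (Suc m)) (Suc (Suc m)) e"
    unfolding polynomial_seq_def
    by (intro exI[of _ "monom e (Suc (Suc m))"]) (auto simp: poly_monom degree_monom_le)
  have "f = (\<lambda>n. g n + e * real n ^ Suc (Suc m))"
    by (auto simp: g_def)
  then show ?case
    using polynomial_seq_add[OF 1 2] by (simp add: e_def)
qed

corollary polynomial_seq_antidifference_fact:
  assumes "polynomial_seq (\<lambda>n. f (Suc n) - f n) m (1 / fact m)" "m' = Suc m"
  shows "polynomial_seq f m' (1 / fact m')"
  using polynomial_seq_antidifference[OF assms(1)] assms(2) by (simp add: mult.commute)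

text \<open>
  The letter at position \<open>k\<close> of the word of a point records whether \<open>D\<^sub>k > 0\<close>, whether \<open>a\<^sub>k > 0\<close>, and
  whether both \<open>D\<^sub>k > 0\<close> and \<open>b\<^sub>k > 0\<close>; where \<open>D\<^sub>k = 0\<close>, the sign of \<open>b\<^sub>k\<close> is determined by the
  rest of the pattern.
\<close>

type_synonym letter = "bool \<times> bool \<times> bool"

text \<open>On words of points of the cone this is the linear dimension of the face, one more than
  its affine dimension.\<close>

fun weight :: "letter list \<Rightarrow> nat" where
  "weight [] = 0"
| "weight ((d, a, b) # w) = of_bool a + of_bool b + weight w"

fun head_D :: "letter list \<Rightarrow> bool" where
  "head_D [] = False"
| "head_D ((d, a, b) # w) = d"

text \<open>A run of positive \<open>D\<^sub>k\<close> is realisable only if \<open>a\<^sub>k > 0\<close> somewhere on it: otherwise \<open>D\<close>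
  would be convex on the run and could not return to zero.\<close>

fun bends :: "letter list \<Rightarrow> bool" where
  "bends [] = False"
| "bends ((d, a, b) # w) = (d \<and> (a \<or> bends w))"

text \<open>A word is read as the final segment of a pattern: its last letter stands for
  \<open>D\<^sub>r = 0\<close>. A run is tested only at the zero letter before it, so a leading run
  may still lack a positive \<open>a\<close>.\<close>

fun good :: "letter list \<Rightarrow> bool" where
  "good [] = False"
| "good [(d, a, b)] = (\<not> d \<and> \<not> b)"
| "good ((d, a, b) # s # w) =
     (good (s # w) \<and> (b \<longrightarrow> d) \<and> (\<not> d \<longrightarrow> head_D (s # w) \<longrightarrow> bends (s # w)))"

lemma good_Cons:
  "w \<noteq> [] \<Longrightarrow> good ((d, a, b) # w) \<longleftrightarrow>
     good w \<and> (b \<longrightarrow> d) \<and> (\<not> d \<longrightarrow> head_D w \<longrightarrow> bends w)"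
  by (cases w) auto

lemma bends_imp_head_D: "bends w \<Longrightarrow> head_D w"
  by (cases w rule: bends.cases) auto

text \<open>The three states of the automaton, counted by \<open>A\<close>, \<open>B\<close> and
  \<open>C\<close>. The length is \<open>Suc n\<close> because the letter for
  \<open>D\<^sub>r\<close> is always present.\<close>

definition words_zero :: "nat \<Rightarrow> letter list set" where
  "words_zero n = {w. length w = Suc n \<and> good w \<and> \<not> head_D w}"
definition words_open :: "nat \<Rightarrow> letter list set" where
  "words_open n = {w. length w = Suc n \<and> good w \<and> head_D w \<and> \<not> bends w}"
definition words_bent :: "nat \<Rightarrow> letter list set" where
  "words_bent n = {w. length w = Suc n \<and> good w \<and> bends w}"

lemma finite_words [simp]: "finite (words_zero n)" "finite (words_open n)" "finite (words_bent n)"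
proof -
  have "finite {w :: letter list. length w = Suc n}"
    using finite_lists_length_eq[of "UNIV :: letter set" "Suc n"] by simp
  then show "finite (words_zero n)" "finite (words_open n)" "finite (words_bent n)"
    unfolding words_zero_def words_open_def words_bent_def by (auto elim: rev_finite_subset)
qed

lemma words_disjoint [simp]: "words_zero n \<inter> words_bent n = {}" "words_zero n \<inter> words_open n = {}" "(words_zero n \<union> words_open n) \<inter> words_bent n = {}"
  by (auto simp: words_zero_def words_open_def words_bent_def dest: bends_imp_head_D)

lemma words_0: "words_zero 0 = {[(False, False, False)], [(False, True, False)]}" "words_open 0 = {}" "words_bent 0 = {}"
  by (auto simp: words_zero_def words_open_def words_bent_def length_Suc_conv)

lemma Cons_in_image_Cons_iff: "x # v \<in> Cons s ` S \<longleftrightarrow> x = s \<and> v \<in> S"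
  by auto

text \<open>A zero letter forces its third entry to be \<open>False\<close> and may not precede an
  open run; its \<open>a\<close> is free.\<close>

lemma words_zero_Suc:
  "words_zero (Suc n) = Cons (False, False, False) ` (words_zero n \<union> words_bent n) \<union> Cons (False, True, False) ` (words_zero n \<union> words_bent n)"
  (is "_ = ?R")
proof (rule set_eqI)
  fix w :: "letter list"
  show "w \<in> words_zero (Suc n) \<longleftrightarrow> w \<in> ?R"
  proof (cases w)
    case (Cons s v)
    obtain d a b where s: "s = (d, a, b)" by (cases s)
    show ?thesis
      using bends_imp_head_D[of v] good_Cons[of v d a b]
      by (cases "v = []"; cases d; cases a; cases b)
        (auto simp only: Cons s Un_iff Cons_in_image_Cons_iff words_zero_def words_bent_def mem_Collect_eq length_Cons
          head_D.simps prod.inject list.size simp_thms nat.inject nat.distinct)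
  qed (auto simp: words_zero_def)
qed

text \<open>The new letter starts or extends a run without contributing an \<open>a\<close>; whether
  \<open>b\<close> is positive is free.\<close>

lemma words_open_Suc:
  "words_open (Suc n) = Cons (True, False, False) ` (words_zero n \<union> words_open n) \<union> Cons (True, False, True) ` (words_zero n \<union> words_open n)"
  (is "_ = ?R")
proof (rule set_eqI)
  fix w :: "letter list"
  show "w \<in> words_open (Suc n) \<longleftrightarrow> w \<in> ?R"
  proof (cases w)
    case (Cons s v)
    obtain d a b where s: "s = (d, a, b)" by (cases s)
    show ?thesis
      using bends_imp_head_D[of v] good_Cons[of v d a b]
      by (cases "v = []"; cases d; cases a; cases b)
        (auto simp only: Cons s Un_iff Cons_in_image_Cons_iff words_zero_def words_open_def mem_Collect_eq length_Cons
          head_D.simps bends.simps prod.inject list.size simp_thms nat.inject nat.distinct)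
  qed (auto simp: words_open_def)
qed

text \<open>Either the run was bent before and the letter has no \<open>a\<close>, or the letter
  itself brings the \<open>a\<close> and any good word may follow.\<close>

lemma words_bent_Suc:
  "words_bent (Suc n) = Cons (True, False, False) ` words_bent n \<union> Cons (True, False, True) ` words_bent n \<union>
    Cons (True, True, False) ` (words_zero n \<union> words_open n \<union> words_bent n) \<union> Cons (True, True, True) ` (words_zero n \<union> words_open n \<union> words_bent n)"
  (is "_ = ?R")
proof (rule set_eqI)
  fix w :: "letter list"
  show "w \<in> words_bent (Suc n) \<longleftrightarrow> w \<in> ?R"
  proof (cases w)
    case (Cons s v)
    obtain d a b where s: "s = (d, a, b)" by (cases s)
    show ?thesis
      using bends_imp_head_D[of v] good_Cons[of v d a b]
      by (cases "v = []"; cases d; cases a; cases b)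
        (auto simp only: Cons s Un_iff Cons_in_image_Cons_iff words_zero_def words_open_def words_bent_def mem_Collect_eq length_Cons
          head_D.simps bends.simps prod.inject list.size simp_thms nat.inject nat.distinct)
  qed (auto simp: words_bent_def)
qed

section \<open>Recurrences by weight and polynomiality\<close>

definition num_weight :: "letter list set \<Rightarrow> nat \<Rightarrow> real" where
  "num_weight S k = real (card {w \<in> S. weight w = k})"

lemma num_weight_Un:
  assumes "finite S" "finite T" "S \<inter> T = {}"
  shows "num_weight (S \<union> T) k = num_weight S k + num_weight T k"
proof -
  have "{w \<in> S \<union> T. weight w = k} = {w \<in> S. weight w = k} \<union> {w \<in> T. weight w = k}" by auto
  then show ?thesis
    unfolding num_weight_def using assms by (simp add: card_Un_disjoint disjoint_iff)
qed

lemma num_weight_Cons: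
  "num_weight (Cons s ` S) k = (if weight [s] \<le> k then num_weight S (k - weight [s]) else 0)"
proof -
  define c where "c = weight [s]"
  have w: "weight (s # v) = c + weight v" for v
    by (cases s) (auto simp: c_def)
  have "{w \<in> Cons s ` S. weight w = k} = Cons s ` {v \<in> S. c + weight v = k}"
    by (auto simp: w)
  then have "num_weight (Cons s ` S) k = real (card {v \<in> S. c + weight v = k})"
    unfolding num_weight_def by (simp add: card_image)
  also have "{v \<in> S. c + weight v = k} = (if c \<le> k then {v \<in> S. weight v = k - c} else {})"
    by auto
  finally show ?thesis by (auto simp: num_weight_def c_def)
qed

lemma num_weight_words_zero_Suc:
  "num_weight (words_zero (Suc n)) k = num_weight (words_zero n) k + num_weight (words_bent n) k +
     (if k \<ge> 1 then num_weight (words_zero n) (k - 1) + num_weight (words_bent n) (k - 1) else 0)"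
  unfolding words_zero_Suc
  by (subst num_weight_Un) (auto simp: num_weight_Cons num_weight_Un)

lemma num_weight_words_open_Suc:
  "num_weight (words_open (Suc n)) k = num_weight (words_zero n) k + num_weight (words_open n) k +
     (if k \<ge> 1 then num_weight (words_zero n) (k - 1) + num_weight (words_open n) (k - 1) else 0)"
  unfolding words_open_Suc
  by (subst num_weight_Un) (auto simp: num_weight_Cons num_weight_Un)

lemma num_weight_words_bent_Suc:
  "num_weight (words_bent (Suc n)) k = num_weight (words_bent n) k +
     (if k \<ge> 1 then num_weight (words_zero n) (k - 1) + num_weight (words_open n) (k - 1) + 2 * num_weight (words_bent n) (k - 1) else 0) +
     (if k \<ge> 2 then num_weight (words_zero n) (k - 2) + num_weight (words_open n) (k - 2) + num_weight (words_bent n) (k - 2) else 0)"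
  unfolding words_bent_Suc
  by (subst num_weight_Un, simp, simp, blast, subst num_weight_Un, simp, simp, blast,
      subst num_weight_Un, simp, simp, blast)
    (auto simp: num_weight_Cons num_weight_Un numeral_2_eq_2)

text \<open>Induction on \<open>k\<close>, treating the bent, zero and open words in this order: the
  difference of the first involves only smaller weights, that of the second also the bent words of
  weight \<open>k\<close>, that of the third also the zero words of weight \<open>k\<close>. The
  coefficient 0 for bent words reflects that their degree is below \<open>3 * k\<close>.\<close>

lemma polynomial_seq_num_weight:
  "polynomial_seq (\<lambda>n. num_weight (words_zero n) k) (3 * k) (1 / fact (3 * k)) \<and>
   polynomial_seq (\<lambda>n. num_weight (words_open n) k) (3 * k + 1) (1 / fact (3 * k + 1)) \<and>
   polynomial_seq (\<lambda>n. num_weight (words_bent n) k) (3 * k) 0"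
proof (induction k rule: less_induct)
  case (less k)
  define A where "A n k = num_weight (words_zero n) k" for n k
  define B where "B n k = num_weight (words_open n) k" for n k
  define C where "C n k = num_weight (words_bent n) k" for n k
  note IH = less.IH[folded A_def B_def C_def]
  note rec = num_weight_words_zero_Suc[folded A_def B_def C_def] num_weight_words_open_Suc[folded A_def B_def C_def]
    num_weight_words_bent_Suc[folded A_def B_def C_def]
  have C0: "C 0 0 = 0" and A0: "A 0 0 = 1"
    by (simp_all add: A_def C_def num_weight_def words_0 Collect_conv_if conj_disj_distribR Collect_disj_eq)
  have zero: "polynomial_seq (\<lambda>n. 0) m 0" for m
    using polynomial_seq_const[of 0] polynomial_seq_mono[of "\<lambda>n. 0" 0 0 m] by (cases m) auto
  show ?case
    unfolding A_def[symmetric] B_def[symmetric] C_def[symmetric]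
  proof (cases k)
    case 0
    \<comment> \<open>Weight 0 forbids any positive \<open>a\<close>, so no run is bent and the only
      zero word has all entries \<open>False\<close>.\<close>
    have C: "C n 0 = 0" for n by (induction n) (auto simp: C0 rec)
    have A: "A n 0 = 1" for n by (induction n) (auto simp: C A0 rec)
    have "polynomial_seq (\<lambda>n. B n 0) (Suc 0) (1 / real (Suc 0))"
      by (rule polynomial_seq_antidifference) (simp add: rec A polynomial_seq_const)
    then show "polynomial_seq (\<lambda>n. A n k) (3 * k) (1 / fact (3 * k)) \<and>
      polynomial_seq (\<lambda>n. B n k) (3 * k + 1) (1 / fact (3 * k + 1)) \<and>
      polynomial_seq (\<lambda>n. C n k) (3 * k) 0"
      using 0 by (simp add: A C polynomial_seq_const zero)
  next
    case (Suc l)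
    have lower: "polynomial_seq (\<lambda>n. A n j) m 0" "polynomial_seq (\<lambda>n. B n j) m 0"
      "polynomial_seq (\<lambda>n. C n j) m 0" if "j < k" "3 * j + 1 < m" for j m
      using IH[OF that(1)] that(2) by (auto intro: polynomial_seq_mono)
    have Al: "polynomial_seq (\<lambda>n. A n l) (3 * l + 1) 0" and Cl: "polynomial_seq (\<lambda>n. C n l) (3 * l + 1) 0"
      and Bl: "polynomial_seq (\<lambda>n. B n l) (3 * l + 1) (1 / fact (3 * l + 1))"
      using IH[of l] Suc by (auto intro: polynomial_seq_mono)
    have two: "polynomial_seq (\<lambda>n. if k \<ge> 2 then A n (k - 2) + B n (k - 2) + C n (k - 2) else 0) (3 * l + 1) 0"
    proof (cases "k \<ge> 2")
      case True
      then have "k - 2 < k" "3 * (k - 2) + 1 < 3 * l + 1" using Suc by auto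
      from lower[OF this] True show ?thesis
        using polynomial_seq_add[OF polynomial_seq_add] by fastforce
    qed (simp add: zero)
    \<comment> \<open>Among the terms of smaller weight only the open words of weight
      \<open>l\<close> reach degree \<open>3 * l + 1\<close>.\<close>
    have "polynomial_seq (\<lambda>n. ((A n l + B n l) + (C n l + C n l)) +
        (if k \<ge> 2 then A n (k - 2) + B n (k - 2) + C n (k - 2) else 0)) (3 * l + 1)
        (((0 + 1 / fact (3 * l + 1)) + (0 + 0)) + 0)"
      by (intro polynomial_seq_add Al Bl Cl two)
    then have dC: "polynomial_seq (\<lambda>n. C (Suc n) k - C n k) (3 * l + 1) (1 / fact (3 * l + 1))"
      by (rule polynomial_seq_cong) (use Suc in \<open>auto simp: rec\<close>)
    have C: "polynomial_seq (\<lambda>n. C n k) (3 * l + 2) (1 / fact (3 * l + 2))"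
      by (rule polynomial_seq_antidifference_fact[OF dC]) simp
    have "polynomial_seq (\<lambda>n. C n k + (A n l + C n l)) (3 * l + 2) (1 / fact (3 * l + 2) + (0 + 0))"
      by (intro polynomial_seq_add C lower) (use Suc in auto)
    then have dA: "polynomial_seq (\<lambda>n. A (Suc n) k - A n k) (3 * l + 2) (1 / fact (3 * l + 2))"
      by (rule polynomial_seq_cong) (use Suc in \<open>auto simp: rec\<close>)
    have A: "polynomial_seq (\<lambda>n. A n k) (3 * k) (1 / fact (3 * k))"
      by (rule polynomial_seq_antidifference_fact[OF dA]) (use Suc in simp)
    have "polynomial_seq (\<lambda>n. A n k + (A n l + B n l)) (3 * k) (1 / fact (3 * k) + (0 + 0))"
      by (intro polynomial_seq_add A lower) (use Suc in auto)
    then have dB: "polynomial_seq (\<lambda>n. B (Suc n) k - B n k) (3 * k) (1 / fact (3 * k))"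
      by (rule polynomial_seq_cong) (use Suc in \<open>auto simp: rec\<close>)
    have B: "polynomial_seq (\<lambda>n. B n k) (3 * k + 1) (1 / fact (3 * k + 1))"
      by (rule polynomial_seq_antidifference_fact[OF dB]) simp
    show "polynomial_seq (\<lambda>n. A n k) (3 * k) (1 / fact (3 * k)) \<and>
      polynomial_seq (\<lambda>n. B n k) (3 * k + 1) (1 / fact (3 * k + 1)) \<and>
      polynomial_seq (\<lambda>n. C n k) (3 * k) 0"
      using A B polynomial_seq_mono[OF C, of "3 * k"] Suc by simp
  qed
qed

theorem num_words_polynomial:
  "\<exists>p :: real poly. degree p = 3 * d + 3 \<and> lead_coeff p = 1 / fact (3 * d + 3) \<and>
     (\<forall>r\<ge>1. real (card {w. length w = r \<and> good ((False, False, False) # w) \<and> weight w = Suc d}) = poly p (real r))"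
proof -
  have "polynomial_seq (\<lambda>n. num_weight (words_zero n) (Suc d) + num_weight (words_bent n) (Suc d))
      (3 * Suc d) (1 / fact (3 * Suc d) + 0)"
    using polynomial_seq_num_weight[of "Suc d"] by (intro polynomial_seq_add) blast+
  then obtain p where p: "degree p \<le> 3 * d + 3" "coeff p (3 * d + 3) = 1 / fact (3 * d + 3)"
      "\<And>n. num_weight (words_zero n \<union> words_bent n) (Suc d) = poly p (real n)"
    unfolding polynomial_seq_def by (auto simp: num_weight_Un algebra_simps)
  have deg: "degree p = 3 * d + 3"
    using p(1,2) by (metis divide_eq_0_iff fact_nonzero le_antisym le_degree zero_neq_one)
  \<comment> \<open>Words of length \<open>r\<close> have index \<open>n = r - 1\<close>; the shift
    of the variable preserves degree and leading coefficient.\<close>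
  define q where "q = p \<circ>\<^sub>p [:-1, 1:]"
  have "lead_coeff q = 1 / fact (3 * d + 3)"
    unfolding q_def using deg p(2) by (subst lead_coeff_comp) simp_all
  moreover have "degree q = 3 * d + 3"
    using deg by (simp add: q_def degree_pcompose)
  moreover have "real (card {w. length w = r \<and> good ((False, False, False) # w) \<and> weight w = Suc d}) = poly q (real r)"
    if "r \<ge> 1" for r
  proof -
    obtain n where r: "r = Suc n" using \<open>r \<ge> 1\<close> by (cases r) auto
    \<comment> \<open>The letter prepended for \<open>D\<^sub>0 = 0\<close> excludes exactly the
      words whose leading run is open.\<close>
    have "{w. length w = r \<and> good ((False, False, False) # w) \<and> weight w = Suc d} =
        {w \<in> words_zero n \<union> words_bent n. weight w = Suc d}"
      by (auto simp: r words_zero_def words_bent_def length_Suc_conv dest: bends_imp_head_D)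
    then show ?thesis
      using p(3)[of n] by (simp add: num_weight_def q_def poly_pcompose r)
  qed
  ultimately show ?thesis by blast
qed

section \<open>Faces of the Kostka polytope\<close>

text \<open>Together with \<open>good_map\<close> this unrolls the recursions into conditions on
  positions, to be compared with \<open>valid_pattern\<close>.\<close>

lemma bends_map:
  assumes "k \<le> r"
  shows "bends (map (\<lambda>l. (d l, a l, b l)) [k..<Suc r]) \<longleftrightarrow>
    (\<exists>m\<ge>k. m \<le> r \<and> a m \<and> (\<forall>l. k \<le> l \<and> l \<le> m \<longrightarrow> d l))"
  using assms
proof (induction k rule: inc_induct)
  case base
  show ?case by (auto simp: le_antisym)
next
  case (step k)
  have "(\<exists>m\<ge>k. m \<le> r \<and> a m \<and> (\<forall>l. k \<le> l \<and> l \<le> m \<longrightarrow> d l)) \<longleftrightarrow>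
      d k \<and> (a k \<or> (\<exists>m\<ge>Suc k. m \<le> r \<and> a m \<and> (\<forall>l. Suc k \<le> l \<and> l \<le> m \<longrightarrow> d l)))" (is "?L \<longleftrightarrow> ?R")
  proof
    assume ?L
    then obtain m where m: "k \<le> m" "m \<le> r" "a m" "\<forall>l. k \<le> l \<and> l \<le> m \<longrightarrow> d l" by blast
    then have "d k" by blast
    moreover have "a k \<or> Suc k \<le> m" using m by (cases "m = k") auto
    ultimately show ?R using m Suc_leD by blast
  next
    assume ?R
    then consider "d k" "a k" | m where "d k" "m \<ge> Suc k" "m \<le> r" "a m" "\<forall>l. Suc k \<le> l \<and> l \<le> m \<longrightarrow> d l"
      by blast
    then show ?L
    proof cases
      case 1
      then show ?thesis using step.hyps by (intro exI[of _ k]) (auto simp: le_antisym)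
    next
      case 2
      have "d l" if "k \<le> l" "l \<le> m" for l
        using that 2 by (cases "l = k") auto
      then show ?thesis using 2 by (intro exI[of _ m]) auto
    qed
  qed
  then show ?case using step by (simp add: upt_conv_Cons del: upt_Suc)
qed

lemma good_map:
  assumes "k \<le> r"
  shows "good (map (\<lambda>l. (d l, a l, b l)) [k..<Suc r]) \<longleftrightarrow>
    \<not> d r \<and> (\<forall>l. k \<le> l \<and> l \<le> r \<longrightarrow> b l \<longrightarrow> d l) \<and>
    (\<forall>i. k \<le> i \<and> i < r \<and> \<not> d i \<and> d (Suc i) \<longrightarrow> bends (map (\<lambda>l. (d l, a l, b l)) [Suc i..<Suc r]))"
  using assms
proof (induction k rule: inc_induct)
  case base
  show ?case by (auto simp: le_antisym)
next
  case (step k)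
  let ?w = "\<lambda>k. map (\<lambda>l. (d l, a l, b l)) [k..<Suc r]"
  have w: "?w k = (d k, a k, b k) # ?w (Suc k)" "?w (Suc k) \<noteq> []"
    and hd: "head_D (?w (Suc k)) \<longleftrightarrow> d (Suc k)"
    using step.hyps by (simp_all add: upt_conv_Cons del: upt_Suc)
  have split: "(\<forall>l. k \<le> l \<and> Q l \<longrightarrow> R l) \<longleftrightarrow> (Q k \<longrightarrow> R k) \<and> (\<forall>l. Suc k \<le> l \<and> Q l \<longrightarrow> R l)" for Q R
    by (metis Suc_leD Suc_leI le_neq_implies_less le_refl)
  show ?case
    unfolding w(1) good_Cons[OF w(2)] step.IH hd
    using split[of "\<lambda>l. l \<le> r" "\<lambda>l. b l \<longrightarrow> d l"]
      split[of "\<lambda>i. i < r \<and> \<not> d i \<and> d (Suc i)" "\<lambda>i. bends (?w (Suc i))"] step.hyps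
    by (auto simp del: upt_Suc)
qed

lemma weight_map:
  "weight (map (\<lambda>l. (d l, a l, b l)) xs) = length (filter a xs) + length (filter b xs)"
  by (induction xs) auto

section \<open>Words of points and their sign patterns\<close>

definition word :: "nat \<Rightarrow> (nat \<Rightarrow>\<^sub>0 real) \<Rightarrow> letter list" where
  "word r x = map (\<lambda>k. (surplus r x k > 0, facet_fun r (Lam k) x > 0,
     surplus r x k > 0 \<and> facet_fun r (Mu k) x > 0)) [1..<Suc r]"

lemma good_word:
  assumes x: "x \<in> ineq_cone r"
  shows "good ((False, False, False) # word r x)"
proof -
  let ?d = "\<lambda>k. surplus r x k > 0" and ?a = "\<lambda>k. facet_fun r (Lam k) x > 0"
  let ?b = "\<lambda>k. surplus r x k > 0 \<and> facet_fun r (Mu k) x > 0"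
  have v: "valid_pattern r ?d ?a (\<lambda>k. facet_fun r (Mu k) x > 0)"
    by (rule valid_pattern_ineq_cone[OF x])
  have "(False, False, False) # word r x = map (\<lambda>k. (?d k, ?a k, ?b k)) [0..<Suc r]"
    by (simp add: word_def upt_conv_Cons del: upt_Suc)
  moreover have "bends (map (\<lambda>k. (?d k, ?a k, ?b k)) [Suc i..<Suc r])"
    if "i < r" "\<not> ?d i" "?d (Suc i)" for i
  proof -
    obtain m where "m > i" "m \<le> r" "?a m" "\<forall>j. i < j \<and> j \<le> m \<longrightarrow> ?d j"
      using v \<open>i < r\<close> \<open>\<not> ?d i\<close> \<open>?d (Suc i)\<close> unfolding valid_pattern_def by blast
    then show ?thesis
      using \<open>i < r\<close> by (subst bends_map) (auto simp: Suc_le_eq simp del: facet_fun.simps)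
  qed
  moreover have "\<not> ?d r" using v by (simp add: valid_pattern_def)
  ultimately show ?thesis
    using good_map[of 0 r ?d ?a ?b] by auto
qed

lemma word_realized:
  assumes w: "length w = r" "good ((False, False, False) # w)"
  shows "\<exists>x\<in>ineq_cone r. word r x = w"
proof -
  define s where "s k = ((False, False, False) # w) ! k" for k
  \<comment> \<open>The bound \<open>k \<le> r\<close> is needed because list entries beyond the end
    are unspecified, while a valid pattern is false there.\<close>
  define d where "d k \<longleftrightarrow> k \<le> r \<and> fst (s k)" for k
  define a where "a k = fst (snd (s k))" for k
  define b where "b k = snd (snd (s k))" for k
  \<comment> \<open>At zeros of \<open>D\<close> the word does not record the sign of
    \<open>b\<close>; it is restored to the value that validity forces.\<close>
  define b' where "b' k \<longleftrightarrow> (if d k then b k else a k \<or> d (k - 1) \<or> d (k + 1))" for k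
  have "map (\<lambda>k. (d k, a k, b k)) [0..<Suc r] = map s [0..<Suc r]"
    by (intro map_cong) (auto simp: d_def a_def b_def)
  also have "\<dots> = (False, False, False) # w"
    using map_nth[of "(False, False, False) # w"] w(1) unfolding s_def by (simp only: length_Cons)
  finally have eq: "map (\<lambda>k. (d k, a k, b k)) [0..<Suc r] = (False, False, False) # w" .
  then have w_eq: "map (\<lambda>k. (d k, a k, b k)) [1..<Suc r] = w"
    by (simp add: upt_conv_Cons del: upt_Suc)
  have "good (map (\<lambda>k. (d k, a k, b k)) [0..<Suc r])" using w(2) eq by simp
  then have g: "\<not> d r" "\<And>l. l \<le> r \<Longrightarrow> b l \<Longrightarrow> d l"
    "\<And>i. i < r \<Longrightarrow> \<not> d i \<Longrightarrow> d (Suc i) \<Longrightarrow> bends (map (\<lambda>l. (d l, a l, b l)) [Suc i..<Suc r])"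
    by (auto simp: good_map simp del: upt_Suc)
  have "valid_pattern r d a b'"
    unfolding valid_pattern_def
  proof (intro conjI allI impI)
    show "\<not> d 0" by (simp add: d_def s_def)
    show "\<not> d k" if "k \<ge> r" for k
      using that g(1) by (cases "k = r") (auto simp: d_def)
    show "b' k \<longleftrightarrow> a k \<or> d (k - 1) \<or> d (k + 1)" if "1 \<le> k \<and> k \<le> r \<and> \<not> d k" for k
      using that by (simp add: b'_def)
    show "\<exists>m>i. m \<le> r \<and> a m \<and> (\<forall>j. i < j \<and> j \<le> m \<longrightarrow> d j)" if "i < r" "\<not> d i \<and> d (Suc i)" for i
    proof -
      have "bends (map (\<lambda>l. (d l, a l, b l)) [Suc i..<Suc r])" using g(3)[of i] that by blast
      moreover have "Suc i \<le> r" using that by simp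
      ultimately show ?thesis by (simp only: bends_map Suc_le_eq)
    qed
  qed
  from pattern_realized[OF this] obtain x where x: "x \<in> ineq_cone r"
    and px: "\<And>c. c \<in> facets r \<Longrightarrow> facet_fun r c x > 0 \<longleftrightarrow> in_pattern d a b' c" by blast
  have "word r x = map (\<lambda>k. (d k, a k, b k)) [1..<Suc r]"
    unfolding word_def
  proof (rule map_cong[OF refl])
    fix k assume "k \<in> set [1..<Suc r]"
    then have k: "1 \<le> k" "k \<le> r" by auto
    then have "Dom k \<in> facets r" "Lam k \<in> facets r" "Mu k \<in> facets r" by (auto simp: facets_def)
    then have "surplus r x k > 0 \<longleftrightarrow> d k" "facet_fun r (Lam k) x > 0 \<longleftrightarrow> a k" "facet_fun r (Mu k) x > 0 \<longleftrightarrow> b' k"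
      using px[of "Dom k"] px[of "Lam k"] px[of "Mu k"] by simp_all
    then show "(surplus r x k > 0, facet_fun r (Lam k) x > 0, surplus r x k > 0 \<and> facet_fun r (Mu k) x > 0) = (d k, a k, b k)"
      using g(2)[OF k(2)] by (auto simp: b'_def)
  qed
  then show ?thesis using x w_eq by metis
qed

text \<open>The one sign missing from a word, that of \<open>b\<^sub>k\<close> where
  \<open>D\<^sub>k = 0\<close>, is recovered from \<open>a\<^sub>k\<close> and the neighbouring
  values of \<open>D\<close>.\<close>

lemma word_eq_iff:
  assumes x: "x \<in> ineq_cone r" and y: "y \<in> ineq_cone r"
  shows "word r x = word r y \<longleftrightarrow> (\<forall>c\<in>facets r. facet_fun r c x = 0 \<longleftrightarrow> facet_fun r c y = 0)"
proof -
  have pos: "facet_fun r c z > 0 \<longleftrightarrow> facet_fun r c z \<noteq> 0" if "c \<in> facets r" "z \<in> ineq_cone r" for c z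
    using that by (force simp: ineq_cone_def)
  have "(\<forall>c\<in>facets r. facet_fun r c x = 0 \<longleftrightarrow> facet_fun r c y = 0) \<longleftrightarrow>
      (\<forall>c\<in>facets r. facet_fun r c x > 0 \<longleftrightarrow> facet_fun r c y > 0)"
    using pos x y by (metis (no_types))
  also have "\<dots> \<longleftrightarrow> (\<forall>k. 1 \<le> k \<and> k \<le> r \<longrightarrow> (surplus r x k > 0 \<longleftrightarrow> surplus r y k > 0) \<and>
      (facet_fun r (Lam k) x > 0 \<longleftrightarrow> facet_fun r (Lam k) y > 0) \<and>
      (facet_fun r (Mu k) x > 0 \<longleftrightarrow> facet_fun r (Mu k) y > 0))"
    by (simp add: ball_facets)
  also have "\<dots> \<longleftrightarrow> word r x = word r y"
  proof
    assume "word r x = word r y"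
    then have e: "(surplus r x k > 0 \<longleftrightarrow> surplus r y k > 0)"
      "(facet_fun r (Lam k) x > 0 \<longleftrightarrow> facet_fun r (Lam k) y > 0)"
      "surplus r x k > 0 \<Longrightarrow> (facet_fun r (Mu k) x > 0 \<longleftrightarrow> facet_fun r (Mu k) y > 0)"
      if "1 \<le> k" "k \<le> r" for k
      using that by (auto simp: word_def simp del: facet_fun.simps upt_Suc)
    have d: "surplus r x k > 0 \<longleftrightarrow> surplus r y k > 0" for k
    proof (cases "1 \<le> k \<and> k \<le> r")
      case False
      then have "surplus r x k = 0" "surplus r y k = 0"
        using surplus_beyond[of x r k] surplus_beyond[of y r k] x y
        by (cases "k = 0"; simp add: ineq_cone_def)+
      then show ?thesis by simp
    qed (use e(1) in blast)
    have "facet_fun r (Mu k) x > 0 \<longleftrightarrow> facet_fun r (Mu k) y > 0" if k: "1 \<le> k" "k \<le> r" for k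
    proof (cases "surplus r x k > 0")
      case False
      then have "facet_fun r (Mu k) z > 0 \<longleftrightarrow>
          facet_fun r (Lam k) z > 0 \<or> surplus r z (k - 1) > 0 \<or> surplus r z (k + 1) > 0" if "z \<in> {x, y}" for z
        using valid_pattern_ineq_cone[of z r] x y d that k unfolding valid_pattern_def by blast
      then show ?thesis using d e(2)[OF k] by blast
    qed (use e(3) k in blast)
    then show "\<forall>k. 1 \<le> k \<and> k \<le> r \<longrightarrow> (surplus r x k > 0 \<longleftrightarrow> surplus r y k > 0) \<and>
      (facet_fun r (Lam k) x > 0 \<longleftrightarrow> facet_fun r (Lam k) y > 0) \<and>
      (facet_fun r (Mu k) x > 0 \<longleftrightarrow> facet_fun r (Mu k) y > 0)"
      using d e(2) by blast
  qed (auto simp: word_def simp del: facet_fun.simps upt_Suc)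
  finally show ?thesis by blast
qed

section \<open>Dimensions of the faces and their number\<close>

lemma linear_coord_sum: "linear (\<lambda>x :: nat \<Rightarrow>\<^sub>0 real. \<Sum>i<n. Poly_Mapping.lookup x i)"
  by (intro linear_compose_sum ballI linear_lookup)

interpretation kostka: cone_section "kostka_space r" "facets r" "facet_fun r"
    "\<lambda>x. \<Sum>i<2 * r. Poly_Mapping.lookup x i" for r
  by (rule cone_section.intro) (rule subspace_kostka_space finite_facets linear_facet_fun linear_coord_sum)+

lemma kostka_polytope_eq: "kostka_polytope r = kostka.slice r"
  by (auto simp: kostka_polytope_def kostka_cone_eq_ineq_cone kostka.slice_def ineq_cone_def)

text \<open>The \<open>2r\<close> functionals \<open>a\<^sub>k\<close> together with \<open>b\<^sub>k\<close> where \<open>D\<^sub>k > 0\<close> and \<open>D\<^sub>k\<close> elsewhere are coordinates,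
  so the dimension is the number of those that do not vanish at \<open>x\<close>.\<close>

lemma dim_carrier_at:
  assumes x: "x \<in> ineq_cone r"
  shows "dim (kostka.carrier_at r x) = weight (word r x)"
proof -
  note nn = ineq_coneD[OF x]
  define g where "g k = (if surplus r x k > 0 then Mu k else Dom k)" for k
  define J where "J = Lam ` {1..r} \<union> g ` {1..r}"
  define N where "N = {c \<in> J. facet_fun r c x = 0}"
  have inj: "inj_on Lam {1..r}" "inj_on g {1..r}" "Lam ` {1..r} \<inter> g ` {1..r} = {}"
    by (auto simp: inj_on_def g_def split: if_splits)
  have cardJ: "card J = 2 * r"
    unfolding J_def using inj by (subst card_Un_disjoint) (auto simp: card_image)
  have xr: "surplus r x r = 0" using x by (simp add: ineq_cone_def kostka_space_def)
  \<comment> \<open>The count runs in the full coordinate space: for \<open>r \<ge> 1\<close> the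
    equation \<open>D\<^sub>r = 0\<close> is itself a condition in \<open>N\<close>, since
    \<open>g r = Dom r\<close>.\<close>
  have dimN: "dim {y \<in> coord_space (2 * r). \<forall>c\<in>N. facet_fun r c y = 0} = card (J - N)"
  proof (rule dim_common_kernel_eq[OF subspace_coord_space coord_space_basis(1)])
    show "dim (coord_space (2 * r)) = card J" by (simp add: cardJ coord_space_basis(2))
    fix y assume y: "y \<in> coord_space (2 * r)" and "\<And>c. c \<in> J \<Longrightarrow> facet_fun r c y = 0"
    then have Jy: "facet_fun r (Lam k) y = 0" "facet_fun r (g k) y = 0" if "1 \<le> k" "k \<le> r" for k
      using that by (auto simp: J_def simp del: facet_fun.simps)
    have lam: "lambda_part r y i = 0" if "i \<le> r" for i
      using lambda_part_zero[OF Jy(1) that] .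
    have "surplus r y r = 0"
      using Jy(2)[of r] xr by (cases "r = 0") (auto simp: g_def)
    have sur: "surplus r y k = 0" if "k \<le> r" for k
    \<comment> \<open>Where \<open>D\<close> of \<open>y\<close> is nonzero, \<open>g k\<close>
      cannot be \<open>Dom k\<close>; so \<open>a\<^sub>k\<close> and \<open>b\<^sub>k\<close> of
      \<open>y\<close> both vanish and \<open>D\<close> is harmonic there.\<close>
    proof (rule discrete_harmonic_zero[where u = "surplus r y", OF surplus_0 \<open>surplus r y r = 0\<close> _ that])
      fix k assume k: "0 < k" "k < r" "surplus r y k \<noteq> 0"
      then have "facet_fun r (Mu k) y = 0"
        using Jy(2)[of k] by (auto simp: g_def split: if_splits)
      then show "2 * surplus r y k = surplus r y (k - 1) + surplus r y (k + 1)"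
        using second_difference[of k r y] Jy(1)[of k] k by simp
    qed
    have "mu_part r y i = 0" if "i < r" for i
      using sur[of i] sur[of "Suc i"] lam[of i] that by (simp add: surplus_def)
    then show "y = 0"
      using lam by (intro coord_space_eq_0I[OF y]) auto
  qed (auto simp: J_def N_def linear_facet_fun)
  have "kostka.carrier_at r x = {y \<in> coord_space (2 * r). \<forall>c\<in>N. facet_fun r c y = 0}"
  proof (intro equalityI subsetI)
    fix y assume y: "y \<in> kostka.carrier_at r x"
    have "c \<in> facets r" if "c \<in> N" for c
      using that by (auto simp: N_def J_def g_def facets_def)
    then have "\<forall>c\<in>N. facet_fun r c y = 0"
      using y unfolding kostka.carrier_at_def N_def by blast
    moreover have "y \<in> kostka_space r" using y unfolding kostka.carrier_at_def by blast
    ultimately show "y \<in> {y \<in> coord_space (2 * r). \<forall>c\<in>N. facet_fun r c y = 0}"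
      by (simp add: kostka_space_def)
  next
    fix y assume "y \<in> {y \<in> coord_space (2 * r). \<forall>c\<in>N. facet_fun r c y = 0}"
    then have y: "y \<in> coord_space (2 * r)" "\<And>c. c \<in> N \<Longrightarrow> facet_fun r c y = 0" by auto
    have D: "surplus r y k = 0" if "1 \<le> k" "k \<le> r" "surplus r x k = 0" for k
    proof -
      have "g k = Dom k" "g k \<in> J" using that by (auto simp: g_def J_def)
      then have "Dom k \<in> N" using that by (auto simp: N_def)
      then show ?thesis using y(2)[of "Dom k"] by simp
    qed
    have A: "facet_fun r (Lam k) y = 0" if "1 \<le> k" "k \<le> r" "facet_fun r (Lam k) x = 0" for k
      using y(2)[of "Lam k"] that by (auto simp: N_def J_def)
    have "surplus r y r = 0"
      using D[of r] xr by (cases "r = 0") auto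
    then have ys: "y \<in> kostka_space r" using y by (simp add: kostka_space_def)
    have D': "surplus r y k = 0" if "surplus r x k = 0" for k
      using D[of k] that surplus_beyond[OF ys, of k] by (cases "k = 0"; cases "k \<le> r") auto
    have B: "facet_fun r (Mu k) y = 0" if k: "1 \<le> k" "k \<le> r" "facet_fun r (Mu k) x = 0" for k
    proof (cases "surplus r x k > 0")
      case True
      then have "g k = Mu k" "g k \<in> J" using k by (auto simp: g_def J_def)
      then show ?thesis using y(2)[of "Mu k"] k by (auto simp: N_def)
    next
      case False
      then have "surplus r x k = 0" using nn(1)[of k] by simp
      \<comment> \<open>With \<open>b\<^sub>k\<close> and \<open>D\<^sub>k\<close> of
        \<open>x\<close> zero, the nonnegative remaining terms of the second difference sum to 0 and
        hence vanish at \<open>x\<close>; the conditions in \<open>N\<close> carry this over to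
        \<open>y\<close>, whose \<open>b\<^sub>k\<close> is then 0.\<close>
      then have "facet_fun r (Lam k) x = 0" "surplus r x (k - 1) = 0" "surplus r x (k + 1) = 0"
        using second_difference[OF k(1), of r x] k(3) nn(1)[of "k - 1"] nn(1)[of "k + 1"] nn(2)[OF k(1,2)]
        by linarith+
      then show ?thesis
        using second_difference[OF k(1), of r y] A[OF k(1,2)] D'[of k] D'[of "k - 1"] D'[of "k + 1"]
          \<open>surplus r x k = 0\<close> by simp
    qed
    show "y \<in> kostka.carrier_at r x"
      using ys D A B unfolding kostka.carrier_at_def ball_facets by (auto simp del: facet_fun.simps(2,3))
  qed
  moreover have "card (J - N) = weight (word r x)"
  proof -
    have "J - N = Lam ` {k \<in> {1..r}. facet_fun r (Lam k) x > 0} \<union>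
        g ` {k \<in> {1..r}. surplus r x k > 0 \<and> facet_fun r (Mu k) x > 0}" (is "_ = ?A \<union> ?B")
    proof -
      have "facet_fun r (Lam k) x \<noteq> 0 \<longleftrightarrow> facet_fun r (Lam k) x > 0" if "k \<in> {1..r}" for k
        using nn(2)[of k] that by auto
      moreover have "facet_fun r (g k) x \<noteq> 0 \<longleftrightarrow> surplus r x k > 0 \<and> facet_fun r (Mu k) x > 0"
        if "k \<in> {1..r}" for k
        using nn(1)[of k] nn(3)[of k] that by (auto simp: g_def)
      ultimately show ?thesis
        unfolding J_def N_def by (auto simp del: facet_fun.simps)
    qed
    moreover have "?A \<inter> ?B = {}" using inj(3) by blast
    ultimately have "card (J - N) = card ?A + card ?B"
      by (simp add: card_Un_disjoint)
    also have "card ?A = card {k \<in> {1..r}. facet_fun r (Lam k) x > 0}"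
      by (rule card_image, rule inj_on_subset[OF inj(1)]) blast
    also have "card ?B = card {k \<in> {1..r}. surplus r x k > 0 \<and> facet_fun r (Mu k) x > 0}"
      by (rule card_image, rule inj_on_subset[OF inj(2)]) blast
    also have "card {k \<in> {1..r}. facet_fun r (Lam k) x > 0} + \<dots> = weight (word r x)"
    proof -
      have "{k. Q k} \<inter> set [1..<Suc r] = {k \<in> {1..r}. Q k}" for Q by auto
      then show ?thesis
        unfolding word_def weight_map by (simp only: distinct_length_filter distinct_upt)
    qed
    finally show ?thesis .
  qed
  ultimately show ?thesis using dimN by simp
qed

text \<open>A face is determined by the signs at a point that generates it, and so is the word of
  that point; every good word of positive weight arises after rescaling into the polytope.\<close>

theorem num_faces_kostka_polytope:
  "num_faces (kostka_polytope r) d =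
     card {w. length w = r \<and> good ((False, False, False) # w) \<and> weight w = Suc d}"
proof -
  let ?X = "{x \<in> kostka.slice r. weight (word r x) = Suc d}"
  have PI: "x \<in> ineq_cone r" if "x \<in> kostka.slice r" for x
    using that by (auto simp: kostka.slice_def ineq_cone_def)
  have "num_faces (kostka_polytope r) d = card (kostka.face_at r ` ?X)"
  proof -
    have "{x \<in> kostka.slice r. dim (kostka.carrier_at r x) = d + 1} = ?X"
      using dim_carrier_at PI by auto
    then show ?thesis by (simp add: kostka_polytope_eq kostka.num_faces_slice)
  qed
  also have "\<dots> = card (word r ` ?X)"
  proof -
    have face_word: "kostka.face_at r x = kostka.face_at r y \<longleftrightarrow> word r x = word r y"
      if "x \<in> ?X" "y \<in> ?X" for x y
      using that PI by (subst word_eq_iff) (auto simp: kostka.face_at_eq_iff)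
    \<comment> \<open>Sends a word to the face of any point with this word; \<open>face_word\<close>
      makes the choice immaterial and \<open>h\<close> injective.\<close>
    define h where "h w = kostka.face_at r (SOME x. x \<in> ?X \<and> word r x = w)" for w
    have h: "h (word r x) = kostka.face_at r x" if "x \<in> ?X" for x
    proof -
      have "(SOME y. y \<in> ?X \<and> word r y = word r x) \<in> ?X \<and> word r (SOME y. y \<in> ?X \<and> word r y = word r x) = word r x"
        using that by (intro someI[of "\<lambda>y. y \<in> ?X \<and> word r y = word r x" x]) auto
      then show ?thesis unfolding h_def using face_word that by blast
    qed
    have "inj_on h (word r ` ?X)"
    proof (rule inj_onI)
      fix u v assume "u \<in> word r ` ?X" "v \<in> word r ` ?X" and huv: "h u = h v"
      then obtain x y where xy: "x \<in> ?X" "u = word r x" "y \<in> ?X" "v = word r y" by blast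
      then have "kostka.face_at r x = kostka.face_at r y" using huv h by simp
      then show "u = v" using face_word xy by simp
    qed
    moreover have "h ` word r ` ?X = kostka.face_at r ` ?X"
      unfolding image_image by (rule image_cong) (auto simp: h)
    ultimately show ?thesis using card_image[of h "word r ` ?X"] by (simp only:)
  qed
  also have "word r ` ?X = {w. length w = r \<and> good ((False, False, False) # w) \<and> weight w = Suc d}"
  proof (intro equalityI subsetI)
    fix w assume "w \<in> word r ` ?X"
    then show "w \<in> {w. length w = r \<and> good ((False, False, False) # w) \<and> weight w = Suc d}"
      using good_word PI by (auto simp: word_def simp del: upt_Suc facet_fun.simps)
  next
    fix w assume "w \<in> {w. length w = r \<and> good ((False, False, False) # w) \<and> weight w = Suc d}"
    then have w: "length w = r" "good ((False, False, False) # w)" "weight w = Suc d" by auto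
    obtain x where x: "x \<in> ineq_cone r" "word r x = w"
      using word_realized[OF w(1,2)] by blast
    define S where "S = (\<Sum>i<2 * r. Poly_Mapping.lookup x i)"
    \<comment> \<open>The weight \<open>Suc d\<close> is positive, whereas the origin has weight 0;
      so the coordinate sum \<open>S\<close> is positive and division by it keeps all signs.\<close>
    have "x \<noteq> 0"
    proof
      assume "x = 0"
      then have f0: "facet_fun r c x = 0" for c using linear_0[OF linear_facet_fun] by blast
      then have "surplus r x k = 0" for k using f0[of "Dom k"] by simp
      then have "word r x = map (\<lambda>k. (False, False, False)) [1..<Suc r]"
        unfolding word_def f0 by simp
      then have "weight (word r x) = 0" by (simp add: weight_map del: upt_Suc)
      then show False using x(2) w(3) by simp
    qed
    then have S: "S > 0" unfolding S_def using x(1) by (intro coord_sum_pos)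
    define y where "y = (1 / S) *\<^sub>R x"
    have fy: "facet_fun r c y = facet_fun r c x / S" for c
      by (simp add: y_def linear_scale[OF linear_facet_fun] del: facet_fun.simps)
    have "(\<Sum>i<2 * r. Poly_Mapping.lookup y i) = 1"
      using S by (simp add: y_def S_def sum_divide_distrib[symmetric])
    moreover have "y \<in> ineq_cone r"
      using x(1) S subspace_kostka_space[of r]
      by (auto simp: ineq_cone_def fy y_def[symmetric] simp del: facet_fun.simps)
        (auto simp: y_def subspace_scale)
    ultimately have "y \<in> kostka.slice r" by (auto simp: kostka.slice_def ineq_cone_def)
    moreover have "word r y = w"
      using x(2) word_eq_iff[OF \<open>y \<in> ineq_cone r\<close> x(1)] S by (simp add: fy del: facet_fun.simps)
    ultimately show "w \<in> word r ` ?X" using w(3) by auto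
  qed
  finally show ?thesis .
qed

theorem theorem5p6:
  fixes d :: nat
  shows "\<exists>p :: real poly.
           degree p = 3 * d + 3 \<and>
           lead_coeff p = 1 / fact (3 * d + 3) \<and>
           (\<forall>r::nat. r \<ge> 1 \<longrightarrow> real (num_faces (kostka_polytope r) d) = poly p (real r))"
  unfolding num_faces_kostka_polytope by (rule num_words_polynomial)

end
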